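(* Let $\mathcal V$ be a commutative quantale and $H:\mathsf{Set}\to\mathcal V\text{-}\mathsf{cat}$ a $\mathcal V\text{-}\mathsf{cat}$-functor. The $\mathcal V\text{-}\mathsf{cat}$-enriched left Kan extension $H^\sharp=\mathrm{Lan}_DH$ of $H$ along the discrete functor $D:\mathsf{Set}\to\mathcal V\text{-}\mathsf{cat}$ is obtained as follows. (1) For a $\mathcal V$-category $\mathcal X$ with set of objects $X_{\mathsf o}$, $H^\sharp\mathcal X$ is the $\mathcal V$-category having the same objects as the $\mathcal V$-category $HX_{\mathsf o}$, and for objects $A',A$, $$H^\sharp\mathcal X(A',A)=\bigvee\{HX_{\mathsf o}(A'_0,A_0)\otimes r_1\otimes HX_{\mathsf o}(A'_1,A_1)\otimes\cdots\otimes r_n\otimes HX_{\mathsf o}(A'_n,A_n)\},$$ where the supremum is taken over all paths $(A'_0,A_0),(A'_1,A_1),\ldots,(A'_n,A_n)$ of pairs of objects of $HX_{\mathsf o}$ with $A'=A'_0$ and $A=A_n$, and all (possibly empty) tuples $(r_1,\ldots,r_n)$ of elements of $\mathcal V$ such that for every $i=1,\ldots,n$ there is an object $C_i$ of $HX_{r_i}$ with $Hd_0^{r_i}(C_i)=A_{i-1}$ and $Hd_1^{r_i}(C_i)=A'_i$. (2) The couniversal cocone $c_{\mathcal X}:HX_{\mathsf o}\to H^\sharp\mathcal X$ is the identity on objects. (3) For a $\mathcal V$-functor $f:\mathcal X\to\mathcal Y$ with object map $f_{\mathsf o}:X_{\mathsf o}\to Y_{\mathsf o}$, $H^\sharp f$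 acts as $Hf_{\mathsf o}$ on objects.
   Context: $\mathcal V=(\mathcal V_o,\otimes,e,[-,-])$ is a commutative quantale: a complete lattice with a commutative, associative, monotone operation $\otimes$ with unit $e$, such that each $-\otimes r$ has a right adjoint $[r,-]$; $\mathcal V$ is assumed non-trivial ($e\neq\bot$). A (small) $\mathcal V$-category $\mathcal X$ is a set of objects together with elements $\mathcal X(x',x)\in\mathcal V_o$ satisfying $e\le\mathcal X(x,x)$ and $\mathcal X(x',x)\otimes\mathcal X(x'',x')\le\mathcal X(x'',x)$; a $\mathcal V$-functor $f:\mathcal X\to\mathcal Y$ is a map on objects with $\mathcal X(x',x)\le\mathcal Y(fx',fx)$. $\mathcal V\text{-}\mathsf{cat}$ is the symmetric monoidal closed category of small $\mathcal V$-categories and $\mathcal V$-functors, with $(\mathcal X\otimes\mathcal Y)((x',y'),(x,y))=\mathcal X(x',x)\otimes\mathcal Y(y',y)$, unit $\mathbb 1$ (one object $0$ with $\mathbb 1(0,0)=e$), and internal hom $[\mathcal Y,\mathcal Z]=\mathcal V\text{-}\mathsf{cat}(\mathcal Y,\mathcal Z)$ of $\mathcal V$-functors with $[\mathcal Y,\mathcal Z](f,g)=\bigwedge_y\mathcal Z(fy,gy)$; it is enriched over itself. $\mathsf{Set}$ is regarded as a $\mathcal V\text{-}\mathsf{cat}$-category whose homs are the discrete $\mathcal V$-categories (distance $e$ between equal objects, $\bot$ otherwise) on the sets of functions; $D:\mathsf{Set}\to\mathcal V\text{-}\mathsf{cat}$ sends a set to the discrete $\mathcal V$-category on it. For $r\in\mathcal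 V_o$, $X_r=\{(x',x)\in X_{\mathsf o}\times X_{\mathsf o}\mid r\le\mathcal X(x',x)\}$, with first and second projections $d^r_0,d^r_1:X_r\to X_{\mathsf o}$. The left Kan extension is in the enriched sense: $(\mathrm{Lan}_DH)\mathcal X$ is the weighted colimit $\mathcal V\text{-}\mathsf{cat}(D-,\mathcal X)*H$. It can be taken to be the weighted colimit $H^\sharp\mathcal X=N*(HF_{\mathcal X})$, where: $\mathbb N$ is the free $\mathcal V\text{-}\mathsf{cat}$-category on the category with objects $\mathsf o$ and all $r\in\mathcal V_o$ and non-identity arrows $\delta^r_0,\delta^r_1:r\to\mathsf o$; $F_{\mathcal X}:\mathbb N\to\mathsf{Set}$ sends $\mathsf o\mapsto X_{\mathsf o}$, $r\mapsto X_r$, $\delta^r_i\mapsto d^r_i$; and the weight $N:\mathbb N^{op}\to\mathcal V\text{-}\mathsf{cat}$ sends $\mathsf o$ to $\mathbb 1$ and $r$ to the $\mathcal V$-category $\mathbb 2_r$ with objects $0,1$, self-distances $e$, $\mathbb 2_r(0,1)=r$, $\mathbb 2_r(1,0)=\bot$, with $N\delta^r_i$ picking $i$. Equivalently, there is a couniversal cocone: a $\mathcal V$-functor $c_{\mathcal X}:HX_{\mathsf o}\to H^\sharp\mathcal X$ with $r\le\bigwedge_{C\in HX_r}H^\sharp\mathcal X(c_{\mathcal X}Hd^r_0(C),c_{\mathcal X}Hd^r_1(C))$ for all $r$, such that every $\mathcal V$-functor $f:HX_{\mathsf o}\to\mathcal Y$ with $r\le\bigwedge_{C\in HX_r}\mathcal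 Y(fHd^r_0(C),fHd^r_1(C))$ for all $r$ factors uniquely as $f=f^\sharp c_{\mathcal X}$, and $\bigwedge_{B\in HX_{\mathsf o}}\mathcal Y(fB,gB)=\bigwedge_{A\in H^\sharp\mathcal X}\mathcal Y(f^\sharp A,g^\sharp A)$ for any two such $f,g$. *)

theory Defs
  imports Main "HOL-Library.FuncSet"
begin

section \<open>Commutative quantales\<close>

text \<open>The tensor is \<open>*\<close> and its unit is \<open>1\<close>; \<open>residual r\<close> is the right adjoint \<open>[r,-]\<close> of \<open>- * r\<close>.
  Monotonicity of \<open>*\<close> follows from the adjunction and commutativity.\<close>

class comm_quantale = complete_lattice + comm_monoid_mult +
  fixes residual :: "'a \<Rightarrow> 'a \<Rightarrow> 'a"
  assumes residual_adjoint: "a * r \<le> b \<longleftrightarrow> a \<le> residual r b"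
    and unit_neq_bot: "1 \<noteq> bot"

section \<open>Categories enriched in a quantale\<close>

text \<open>Values of \<open>dist\<close> outside the carrier \<open>objs\<close> are irrelevant; two records differing only there
  are isomorphic via the identity.\<close>

record ('o, 'v) vcat =
  objs :: "'o set"
  dist :: "'o \<Rightarrow> 'o \<Rightarrow> 'v"

definition vcategory :: "('o, 'v::comm_quantale) vcat \<Rightarrow> bool" where
  "vcategory X \<longleftrightarrow>
     (\<forall>x\<in>objs X. 1 \<le> dist X x x) \<and>
     (\<forall>x\<in>objs X. \<forall>x'\<in>objs X. \<forall>x''\<in>objs X. dist X x' x * dist X x'' x' \<le> dist X x'' x)"

definition vfunctor :: "('a, 'v::comm_quantale) vcat \<Rightarrow> ('b, 'v) vcat \<Rightarrow> ('a \<Rightarrow> 'b) \<Rightarrow> bool" where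
  "vfunctor X Y f \<longleftrightarrow>
     f \<in> objs X \<rightarrow> objs Y \<and>
     (\<forall>x'\<in>objs X. \<forall>x\<in>objs X. dist X x' x \<le> dist Y (f x') (f x))"

definition tensor :: "('a, 'v::comm_quantale) vcat \<Rightarrow> ('b, 'v) vcat \<Rightarrow> ('a \<times> 'b, 'v) vcat" where
  "tensor X Y = \<lparr>objs = objs X \<times> objs Y,
     dist = (\<lambda>(x', y') (x, y). dist X x' x * dist Y y' y)\<rparr>"

text \<open>The internal hom. Its objects are extensional functions, so that equal V-functors are
  equal as HOL functions.\<close>

definition vfun :: "('a, 'v::comm_quantale) vcat \<Rightarrow> ('b, 'v) vcat \<Rightarrow> ('a \<Rightarrow> 'b, 'v) vcat" where
  "vfun Y Z = \<lparr>objs = {f \<in> extensional (objs Y). vfunctor Y Z f},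
     dist = (\<lambda>f g. INF y\<in>objs Y. dist Z (f y) (g y))\<rparr>"

definition discrete :: "'o set \<Rightarrow> ('o, 'v::comm_quantale) vcat" where
  "discrete S = \<lparr>objs = S, dist = (\<lambda>x y. if x = y then 1 else bot)\<rparr>"

definition vcat_iso :: "('a, 'v::comm_quantale) vcat \<Rightarrow> ('b, 'v) vcat \<Rightarrow> ('a \<Rightarrow> 'b) \<Rightarrow> bool" where
  "vcat_iso X Y f \<longleftrightarrow>
     bij_betw f (objs X) (objs Y) \<and>
     (\<forall>x'\<in>objs X. \<forall>x\<in>objs X. dist X x' x = dist Y (f x') (f x))"

section \<open>Categories enriched in V-cat\<close>

text \<open>The composition \<open>EComp K a b c\<close> takes an object of \<open>EHom K b c\<close> first and one of \<open>EHom K a b\<close>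
  second.\<close>

record ('o, 'm, 'v) ecat =
  EOb :: "'o set"
  EHom :: "'o \<Rightarrow> 'o \<Rightarrow> ('m, 'v) vcat"
  EId :: "'o \<Rightarrow> 'm"
  EComp :: "'o \<Rightarrow> 'o \<Rightarrow> 'o \<Rightarrow> 'm \<Rightarrow> 'm \<Rightarrow> 'm"

definition vcat_category :: "('o, 'm, 'v::comm_quantale) ecat \<Rightarrow> bool" where
  "vcat_category K \<longleftrightarrow>
     (\<forall>a\<in>EOb K. \<forall>b\<in>EOb K. vcategory (EHom K a b)) \<and>
     (\<forall>a\<in>EOb K. EId K a \<in> objs (EHom K a a)) \<and>
     (\<forall>a\<in>EOb K. \<forall>b\<in>EOb K. \<forall>c\<in>EOb K.
        vfunctor (tensor (EHom K b c) (EHom K a b)) (EHom K a c) (\<lambda>(g, f). EComp K a b c g f)) \<and>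
     (\<forall>a\<in>EOb K. \<forall>b\<in>EOb K. \<forall>f\<in>objs (EHom K a b).
        EComp K a b b (EId K b) f = f \<and> EComp K a a b f (EId K a) = f) \<and>
     (\<forall>a\<in>EOb K. \<forall>b\<in>EOb K. \<forall>c\<in>EOb K. \<forall>d\<in>EOb K.
        \<forall>f\<in>objs (EHom K a b). \<forall>g\<in>objs (EHom K b c). \<forall>h\<in>objs (EHom K c d).
          EComp K a c d h (EComp K a b c g f) = EComp K a b d (EComp K b c d h g) f)"

definition opposite :: "('o, 'm, 'v) ecat \<Rightarrow> ('o, 'm, 'v) ecat" where
  "opposite K = \<lparr>EOb = EOb K, EHom = (\<lambda>a b. EHom K b a), EId = EId K,
     EComp = (\<lambda>a b c g f. EComp K c b a f g)\<rparr>"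

record ('o, 'm, 'p, 'n) efunctor =
  FOb :: "'o \<Rightarrow> 'p"
  FMor :: "'o \<Rightarrow> 'o \<Rightarrow> 'm \<Rightarrow> 'n"

definition vcat_functor ::
  "('o, 'm, 'v::comm_quantale) ecat \<Rightarrow> ('p, 'n, 'v) ecat \<Rightarrow> ('o, 'm, 'p, 'n) efunctor \<Rightarrow> bool" where
  "vcat_functor A B F \<longleftrightarrow>
     vcat_category A \<and> vcat_category B \<and>
     (\<forall>a\<in>EOb A. FOb F a \<in> EOb B) \<and>
     (\<forall>a\<in>EOb A. \<forall>b\<in>EOb A. vfunctor (EHom A a b) (EHom B (FOb F a) (FOb F b)) (FMor F a b)) \<and>
     (\<forall>a\<in>EOb A. FMor F a a (EId A a) = EId B (FOb F a)) \<and>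
     (\<forall>a\<in>EOb A. \<forall>b\<in>EOb A. \<forall>c\<in>EOb A. \<forall>f\<in>objs (EHom A a b). \<forall>g\<in>objs (EHom A b c).
        FMor F a c (EComp A a b c g f) =
        EComp B (FOb F a) (FOb F b) (FOb F c) (FMor F b c g) (FMor F a b f))"

definition efunctor_comp ::
  "('p, 'n, 'q, 'l) efunctor \<Rightarrow> ('o, 'm, 'p, 'n) efunctor \<Rightarrow> ('o, 'm, 'q, 'l) efunctor" where
  "efunctor_comp G F = \<lparr>FOb = (\<lambda>a. FOb G (FOb F a)),
     FMor = (\<lambda>a b f. FMor G (FOb F a) (FOb F b) (FMor F a b f))\<rparr>"

section \<open>Set and V-cat\<close>

text \<open>A universe of small sets whose elements live in the type \<open>'u\<close>. Of the closure properties
  of the class of all small sets, only those needed to form \<open>X\<^sub>r \<subseteq> X \<times> X\<close> inside the universe are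
  demanded; \<open>pair\<close> is the ordered pair of the universe. Instances are the elements of a
  Grothendieck universe, and all subsets of an arbitrary infinite type.\<close>

definition set_universe :: "('u set \<Rightarrow> bool) \<Rightarrow> ('u \<times> 'u \<Rightarrow> 'u) \<Rightarrow> bool" where
  "set_universe small pair \<longleftrightarrow>
     inj pair \<and>
     (\<forall>A B. small A \<longrightarrow> B \<subseteq> A \<longrightarrow> small B) \<and>
     (\<forall>A B. small A \<longrightarrow> small B \<longrightarrow> small (pair ` (A \<times> B)))"

definition SetC :: "('u set \<Rightarrow> bool) \<Rightarrow> ('u set, 'u \<Rightarrow> 'u, 'v::comm_quantale) ecat" where
  "SetC small = \<lparr>EOb = {S. small S}, EHom = (\<lambda>S T. discrete (S \<rightarrow>\<^sub>E T)),
     EId = (\<lambda>S. \<lambda>x\<in>S. x), EComp = (\<lambda>R S T g f. compose R g f)\<rparr>"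

definition VCat :: "('o set \<Rightarrow> bool) \<Rightarrow> (('o, 'v::comm_quantale) vcat, 'o \<Rightarrow> 'o, 'v) ecat" where
  "VCat small = \<lparr>EOb = {X. vcategory X \<and> small (objs X)}, EHom = vfun,
     EId = (\<lambda>X. \<lambda>x\<in>objs X. x), EComp = (\<lambda>X Y Z g f. compose (objs X) g f)\<rparr>"

text \<open>V-cat with no size restriction on the object sets (over a given type). Weights and
  representables take values here; this is only a larger codomain and places no condition on them.\<close>

abbreviation VCAT :: "(('o, 'v::comm_quantale) vcat, 'o \<Rightarrow> 'o, 'v) ecat" where
  "VCAT \<equiv> VCat (\<lambda>_. True)"

definition Disc :: "('u set, 'u \<Rightarrow> 'u, ('u, 'v::comm_quantale) vcat, 'u \<Rightarrow> 'u) efunctor" where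
  "Disc = \<lparr>FOb = discrete, FMor = (\<lambda>S T f. f)\<rparr>"

section \<open>Weighted colimits and left Kan extensions\<close>

text \<open>Transformations between V-cat-functors \<open>F\<close>, \<open>G\<close> from \<open>K\<close> to V-cat; the values of \<open>F\<close> and of
  \<open>G\<close> may have objects of different HOL types. Since V-functors are determined by their object
  maps, the enriched naturality square amounts to commutation on objects.\<close>

definition vcat_nat ::
  "('k, 'm, 'v::comm_quantale) ecat \<Rightarrow> ('k, 'm, ('a, 'v) vcat, 'a \<Rightarrow> 'a) efunctor \<Rightarrow>
   ('k, 'm, ('b, 'v) vcat, 'b \<Rightarrow> 'b) efunctor \<Rightarrow> ('k \<Rightarrow> 'a \<Rightarrow> 'b) \<Rightarrow> bool" where
  "vcat_nat K F G \<alpha> \<longleftrightarrow>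
     (\<forall>k\<in>EOb K. \<alpha> k \<in> objs (vfun (FOb F k) (FOb G k))) \<and>
     (\<forall>k\<in>EOb K. \<forall>l\<in>EOb K. \<forall>h\<in>objs (EHom K k l). \<forall>x\<in>objs (FOb F k).
        \<alpha> l (FMor F k l h x) = FMor G k l h (\<alpha> k x))"

text \<open>The V-category \<open>[K, V-cat](F, G)\<close>, i.e. the end of \<open>[F k, G k]\<close> over \<open>k\<close>.\<close>

definition nat_hom ::
  "('k, 'm, 'v::comm_quantale) ecat \<Rightarrow> ('k, 'm, ('a, 'v) vcat, 'a \<Rightarrow> 'a) efunctor \<Rightarrow>
   ('k, 'm, ('b, 'v) vcat, 'b \<Rightarrow> 'b) efunctor \<Rightarrow> ('k \<Rightarrow> 'a \<Rightarrow> 'b, 'v) vcat" where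
  "nat_hom K F G = \<lparr>objs = {\<alpha> \<in> extensional (EOb K). vcat_nat K F G \<alpha>},
     dist = (\<lambda>\<alpha> \<beta>. INF k\<in>EOb K. dist (vfun (FOb F k) (FOb G k)) (\<alpha> k) (\<beta> k))\<rparr>"

text \<open>The functor \<open>C(G-, Y)\<close> from the opposite of the domain of \<open>G\<close> to V-cat.\<close>

definition hom_into ::
  "('p, 'n, 'v::comm_quantale) ecat \<Rightarrow> ('k, 'm, 'p, 'n) efunctor \<Rightarrow> 'p \<Rightarrow>
   ('k, 'm, ('n, 'v) vcat, 'n \<Rightarrow> 'n) efunctor" where
  "hom_into C G Y = \<lparr>FOb = (\<lambda>k. EHom C (FOb G k) Y),
     FMor = (\<lambda>k l h. \<lambda>f\<in>objs (EHom C (FOb G k) Y).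
       EComp C (FOb G l) (FOb G k) Y f (FMor G l k h))\<rparr>"

text \<open>\<open>\<xi>\<close> exhibits the V-category \<open>Z\<close> as the colimit \<open>W * G\<close> in \<open>VCat small\<close> of \<open>G\<close> weighted by \<open>W\<close>.\<close>

definition weighted_colimit ::
  "('k, 'm, 'v::comm_quantale) ecat \<Rightarrow> ('k, 'm, ('w, 'v) vcat, 'w \<Rightarrow> 'w) efunctor \<Rightarrow>
   ('u set \<Rightarrow> bool) \<Rightarrow> ('k, 'm, ('u, 'v) vcat, 'u \<Rightarrow> 'u) efunctor \<Rightarrow>
   ('u, 'v) vcat \<Rightarrow> ('k \<Rightarrow> 'w \<Rightarrow> 'u \<Rightarrow> 'u) \<Rightarrow> bool" where
  "weighted_colimit K W small G Z \<xi> \<longleftrightarrow>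
     vcat_functor (opposite K) VCAT W \<and>
     vcat_functor K (VCat small) G \<and>
     Z \<in> EOb (VCat small) \<and>
     vcat_nat (opposite K) W (hom_into (VCat small) G Z) \<xi> \<and>
     (\<forall>Y\<in>EOb (VCat small).
        vcat_iso (vfun Z Y) (nat_hom (opposite K) W (hom_into (VCat small) G Y))
          (\<lambda>f. \<lambda>k\<in>EOb K. \<lambda>w\<in>objs (FOb W k). compose (objs (FOb G k)) f (\<xi> k w)))"

text \<open>\<open>\<phi> : H \<Rightarrow> L J\<close> exhibits \<open>L\<close> as the (pointwise) left Kan extension of \<open>H\<close> along \<open>J : A \<rightarrow> C\<close>: for each
  object \<open>X\<close> of \<open>C\<close>, the induced
  \<open>C(J-, X) \<rightarrow> V-cat(L J-, L X) \<rightarrow> V-cat(H-, L X)\<close> exhibits \<open>L X\<close> as the colimit \<open>C(J-, X) * H\<close>.\<close>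

definition left_kan_extension ::
  "('a, 'm, 'v::comm_quantale) ecat \<Rightarrow> ('c, 'n, 'v) ecat \<Rightarrow> ('u set \<Rightarrow> bool) \<Rightarrow>
   ('a, 'm, 'c, 'n) efunctor \<Rightarrow> ('a, 'm, ('u, 'v) vcat, 'u \<Rightarrow> 'u) efunctor \<Rightarrow>
   ('c, 'n, ('u, 'v) vcat, 'u \<Rightarrow> 'u) efunctor \<Rightarrow> ('a \<Rightarrow> 'u \<Rightarrow> 'u) \<Rightarrow> bool" where
  "left_kan_extension A C small J H L \<phi> \<longleftrightarrow>
     vcat_functor A C J \<and>
     vcat_functor A (VCat small) H \<and>
     vcat_functor C (VCat small) L \<and>
     vcat_nat A H (efunctor_comp L J) \<phi> \<and>
     (\<forall>X\<in>EOb C.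
        weighted_colimit A (hom_into C J X) small H (FOb L X)
          (\<lambda>a. \<lambda>g\<in>objs (EHom C (FOb J a) X).
             compose (objs (FOb H a)) (FMor L (FOb J a) X g) (\<phi> a)))"

section \<open>Thresholds, paths and couniversal cocones\<close>

definition threshold :: "('u \<times> 'u \<Rightarrow> 'u) \<Rightarrow> ('u, 'v::comm_quantale) vcat \<Rightarrow> 'v \<Rightarrow> 'u set" where
  "threshold pair X r = pair ` {(x', x) \<in> objs X \<times> objs X. r \<le> dist X x' x}"

definition d0 :: "('u \<times> 'u \<Rightarrow> 'u) \<Rightarrow> ('u, 'v::comm_quantale) vcat \<Rightarrow> 'v \<Rightarrow> 'u \<Rightarrow> 'u" where
  "d0 pair X r = (\<lambda>p\<in>threshold pair X r. fst (inv pair p))"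

definition d1 :: "('u \<times> 'u \<Rightarrow> 'u) \<Rightarrow> ('u, 'v::comm_quantale) vcat \<Rightarrow> 'v \<Rightarrow> 'u \<Rightarrow> 'u" where
  "d1 pair X r = (\<lambda>p\<in>threshold pair X r. snd (inv pair p))"

definition Hd0 ::
  "('u set, 'u \<Rightarrow> 'u, ('u, 'v::comm_quantale) vcat, 'u \<Rightarrow> 'u) efunctor \<Rightarrow> ('u \<times> 'u \<Rightarrow> 'u) \<Rightarrow>
   ('u, 'v) vcat \<Rightarrow> 'v \<Rightarrow> 'u \<Rightarrow> 'u" where
  "Hd0 H pair X r = FMor H (threshold pair X r) (objs X) (d0 pair X r)"

definition Hd1 ::
  "('u set, 'u \<Rightarrow> 'u, ('u, 'v::comm_quantale) vcat, 'u \<Rightarrow> 'u) efunctor \<Rightarrow> ('u \<times> 'u \<Rightarrow> 'u) \<Rightarrow>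
   ('u, 'v) vcat \<Rightarrow> 'v \<Rightarrow> 'u \<Rightarrow> 'u" where
  "Hd1 H pair X r = FMor H (threshold pair X r) (objs X) (d1 pair X r)"

text \<open>The products over whose set the supremum is taken; \<open>P i\<close> and \<open>Q i\<close> are the two components
  of the \<open>i\<close>-th pair of the path, and \<open>r\<close> is only used at \<open>1, \<dots>, n\<close>.\<close>

definition path_values ::
  "('u set, 'u \<Rightarrow> 'u, ('u, 'v::comm_quantale) vcat, 'u \<Rightarrow> 'u) efunctor \<Rightarrow> ('u \<times> 'u \<Rightarrow> 'u) \<Rightarrow>
   ('u, 'v) vcat \<Rightarrow> 'u \<Rightarrow> 'u \<Rightarrow> 'v set" where
  "path_values H pair X A' A =
     {dist (FOb H (objs X)) (P 0) (Q 0) * (\<Prod>i=1..n. r i * dist (FOb H (objs X)) (P i) (Q i))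
      | (n::nat) P Q r.
        (\<forall>i\<le>n. P i \<in> objs (FOb H (objs X)) \<and> Q i \<in> objs (FOb H (objs X))) \<and>
        P 0 = A' \<and> Q n = A \<and>
        (\<forall>i\<in>{1..n}. \<exists>C\<in>objs (FOb H (threshold pair X (r i))).
           Hd0 H pair X (r i) C = Q (i - 1) \<and> Hd1 H pair X (r i) C = P i)}"

definition cocone ::
  "('u set, 'u \<Rightarrow> 'u, ('u, 'v::comm_quantale) vcat, 'u \<Rightarrow> 'u) efunctor \<Rightarrow> ('u \<times> 'u \<Rightarrow> 'u) \<Rightarrow>
   ('u, 'v) vcat \<Rightarrow> ('u, 'v) vcat \<Rightarrow> ('u \<Rightarrow> 'u) \<Rightarrow> bool" where
  "cocone H pair X Y f \<longleftrightarrow>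
     f \<in> objs (vfun (FOb H (objs X)) Y) \<and>
     (\<forall>r. r \<le> (INF C\<in>objs (FOb H (threshold pair X r)).
                 dist Y (f (Hd0 H pair X r C)) (f (Hd1 H pair X r C))))"

definition couniversal_cocone ::
  "('u set \<Rightarrow> bool) \<Rightarrow> ('u set, 'u \<Rightarrow> 'u, ('u, 'v::comm_quantale) vcat, 'u \<Rightarrow> 'u) efunctor \<Rightarrow>
   ('u \<times> 'u \<Rightarrow> 'u) \<Rightarrow> ('u, 'v) vcat \<Rightarrow> ('u, 'v) vcat \<Rightarrow> ('u \<Rightarrow> 'u) \<Rightarrow> bool" where
  "couniversal_cocone small H pair X Z c \<longleftrightarrow>
     Z \<in> EOb (VCat small) \<and>
     cocone H pair X Z c \<and>
     (\<forall>Y\<in>EOb (VCat small). \<forall>f. cocone H pair X Y f \<longrightarrow>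
        (\<exists>!f'. f' \<in> objs (vfun Z Y) \<and> f = compose (objs (FOb H (objs X))) f' c)) \<and>
     (\<forall>Y\<in>EOb (VCat small). \<forall>f g. \<forall>f'\<in>objs (vfun Z Y). \<forall>g'\<in>objs (vfun Z Y).
        cocone H pair X Y f \<longrightarrow> cocone H pair X Y g \<longrightarrow>
        f = compose (objs (FOb H (objs X))) f' c \<longrightarrow>
        g = compose (objs (FOb H (objs X))) g' c \<longrightarrow>
        (INF B\<in>objs (FOb H (objs X)). dist Y (f B) (g B)) =
        (INF A\<in>objs Z. dist Y (f' A) (g' A)))"

section \<open>Well-definedness of the basic enriched categories\<close>

lemma quantale_mult_mono:
  fixes a b c d :: "'v::comm_quantale"
  assumes "a \<le> b" "c \<le> d"
  shows "a * c \<le> b * d"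
proof -
  have 1: "x * z \<le> y * z" if "x \<le> y" for x y z :: 'v
    using that residual_adjoint order_refl order_trans by metis
  have "a * c \<le> b * c" by (rule 1[OF assms(1)])
  also have "b * c = c * b" by (rule mult.commute)
  also have "c * b \<le> d * b" by (rule 1[OF assms(2)])
  finally show ?thesis by (simp add: mult.commute)
qed

lemma quantale_mult_bot [simp]: "(bot::'v::comm_quantale) * a = bot" "a * (bot::'v) = bot"
proof -
  show "(bot::'v) * a = bot"
    using residual_adjoint[of bot a bot] by (simp add: bot_unique)
  then show "a * (bot::'v) = bot" by (simp add: mult.commute)
qed

lemma vcategory_discrete: "vcategory (discrete S)"
  by (auto simp: vcategory_def discrete_def)

lemma vcategory_vfun:
  assumes "vcategory Z"
  shows "vcategory (vfun Y Z)"
proof -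
  have "dist Z (g y) (h y) * dist Z (f y) (g y) \<le> dist Z (f y) (h y)"
    if "f \<in> objs (vfun Y Z)" "g \<in> objs (vfun Y Z)" "h \<in> objs (vfun Y Z)" "y \<in> objs Y" for f g h y
    using that assms by (auto simp: vcategory_def vfun_def vfunctor_def Pi_iff)
  then show ?thesis
    using assms
    by (auto simp: vcategory_def vfun_def vfunctor_def Pi_iff intro!: INF_greatest)
       (meson INF_lower order_trans quantale_mult_mono)
qed

lemma vcat_category_SetC: "vcat_category (SetC small :: ('u set, 'u \<Rightarrow> 'u, 'v::comm_quantale) ecat)"
  unfolding vcat_category_def SetC_def
  by (auto simp: vcategory_discrete)
     (auto simp: discrete_def vfunctor_def tensor_def compose_def fun_eq_iff PiE_iff extensional_def)

lemma vcat_category_VCat: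
  "vcat_category (VCat small :: (('a, 'b::comm_quantale) vcat, 'a \<Rightarrow> 'a, 'b) ecat)"
  unfolding vcat_category_def
proof (intro conjI ballI)
  fix X Y Z :: "('a, 'b) vcat"
  assume "X \<in> EOb (VCat small)" "Y \<in> EOb (VCat small)" and Z: "Z \<in> EOb (VCat small)"
  show "vfunctor (tensor (EHom (VCat small) Y Z) (EHom (VCat small) X Y)) (EHom (VCat small) X Z)
          (\<lambda>(g, f). EComp (VCat small) X Y Z g f)"
  proof -
    have "(INF y\<in>objs Y. dist Z (g y) (g' y)) * (INF x\<in>objs X. dist Y (f x) (f' x))
            \<le> dist Z (g (f x)) (g' (f' x))"
      if g: "vfunctor Y Z g" "vfunctor Y Z g'" and f: "vfunctor X Y f" "vfunctor X Y f'"
        and x: "x \<in> objs X" for f f' g g' x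
    proof -
      have fx: "f x \<in> objs Y" "f' x \<in> objs Y"
        using f x by (auto simp: vfunctor_def)
      have "(INF x\<in>objs X. dist Y (f x) (f' x)) \<le> dist Y (f x) (f' x)"
        using x by (rule INF_lower)
      also have "\<dots> \<le> dist Z (g (f x)) (g (f' x))"
        using g fx by (auto simp: vfunctor_def)
      finally have 1: "(INF x\<in>objs X. dist Y (f x) (f' x)) \<le> dist Z (g (f x)) (g (f' x))" .
      have 2: "(INF y\<in>objs Y. dist Z (g y) (g' y)) \<le> dist Z (g (f' x)) (g' (f' x))"
        using fx(2) by (rule INF_lower)
      have "dist Z (g (f' x)) (g' (f' x)) * dist Z (g (f x)) (g (f' x))
              \<le> dist Z (g (f x)) (g' (f' x))"
        using Z g fx by (auto simp: VCat_def vcategory_def vfunctor_def Pi_iff)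
      with quantale_mult_mono[OF 2 1] show ?thesis by (rule order_trans)
    qed
    moreover have "vfunctor X Z (compose (objs X) g f)"
      if "vfunctor Y Z g" "vfunctor X Y f" for f g
      using that unfolding vfunctor_def compose_def
      by (auto simp: Pi_iff) (meson order_trans)
    ultimately show ?thesis
      unfolding vfunctor_def[of "tensor _ _"]
      by (auto simp: tensor_def VCat_def vfun_def compose_eq
               intro!: INF_greatest)
  qed
qed (auto simp: VCat_def vcategory_vfun, auto simp: vfun_def vfunctor_def compose_def fun_eq_iff
       extensional_def Pi_iff)

lemma vcat_functor_Disc:
  "vcat_functor (SetC small) (VCat small)
     (Disc :: ('u set, 'u \<Rightarrow> 'u, ('u, 'v::comm_quantale) vcat, 'u \<Rightarrow> 'u) efunctor)"
proof -
  have *: "objs (vfun (discrete S) (discrete T :: ('u, 'v) vcat)) = S \<rightarrow>\<^sub>E T" for S T :: "'u set"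
    by (auto simp: vfun_def discrete_def vfunctor_def PiE_def Pi_iff)
  have "vfunctor (discrete (S \<rightarrow>\<^sub>E T)) (vfun (discrete S) (discrete T :: ('u, 'v) vcat)) (\<lambda>f. f)"
    for S T :: "'u set"
    unfolding vfunctor_def using *[of S T]
    by (auto simp: discrete_def vfun_def intro!: INF_greatest)
  then show ?thesis
    unfolding vcat_functor_def
    by (auto simp: vcat_category_SetC vcat_category_VCat)
       (auto simp: SetC_def VCat_def Disc_def vcategory_discrete, auto simp: discrete_def)
qed

end

theory Submission
  imports Defs
begin

text \<open>A V-category structure is generated on the objects of \<open>H X\<^sub>o\<close> by forcing \<open>r\<close> to be a lower bound
  for the distance from \<open>H d\<^sub>0 C\<close> to \<open>H d\<^sub>1 C\<close>, for all \<open>C\<close> in \<open>H X\<^sub>r\<close>; the suprema over paths solve this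
  universal problem, so V-functors out of the result are exactly the cocones. The threshold sets
  detect distances between functions into \<open>X\<^sub>o\<close>: functions \<open>f, g : S \<rightarrow> X\<^sub>o\<close> are at distance at
  least \<open>r\<close> iff \<open>(f, g)\<close> factors through \<open>X\<^sub>r\<close>. This makes \<open>H\<^sup>\<sharp>\<close> enriched, and turns
  transformations \<open>V-cat(D-, X) \<Rightarrow> V-cat(H-, Y)\<close> into cocones by evaluation at the identity of
  \<open>X\<^sub>o\<close>, which gives the universal property of the weighted colimit.\<close>

section \<open>Quantales, V-functors and homs\<close>

text \<open>\<open>a * -\<close> is a left adjoint: an upper bound of all products transposes to the
  upper bound \<open>residual a b\<close> of \<open>S\<close>.\<close>

lemma quantale_mult_Sup_le:
  fixes a b :: "'v::comm_quantale"
  assumes "\<And>s. s \<in> S \<Longrightarrow> a * s \<le> b"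
  shows "a * Sup S \<le> b"
proof -
  have "Sup S \<le> residual a b"
    using assms by (intro Sup_least) (metis mult.commute residual_adjoint)
  then show ?thesis
    by (metis mult.commute residual_adjoint)
qed

lemma quantale_Sup_mult_Sup_le:
  fixes b :: "'v::comm_quantale"
  assumes "\<And>s t. s \<in> S \<Longrightarrow> t \<in> T \<Longrightarrow> s * t \<le> b"
  shows "Sup S * Sup T \<le> b"
  using assms by (metis mult.commute quantale_mult_Sup_le)

lemma quantale_le_mult:
  fixes a b c :: "'v::comm_quantale"
  assumes "1 \<le> a" "b \<le> c"
  shows "b \<le> a * c" "b \<le> c * a"
  using quantale_mult_mono[OF assms] by (simp_all add: mult.commute)

lemma vcategory_id: "vcategory X \<Longrightarrow> x \<in> objs X \<Longrightarrow> 1 \<le> dist X x x"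
  by (simp add: vcategory_def)

lemma vcategory_comp:
  "vcategory X \<Longrightarrow> x \<in> objs X \<Longrightarrow> y \<in> objs X \<Longrightarrow> z \<in> objs X \<Longrightarrow> dist X y z * dist X x y \<le> dist X x z"
  by (simp add: vcategory_def)

lemma mem_vfun [simp]: "f \<in> objs (vfun X Y) \<longleftrightarrow> f \<in> extensional (objs X) \<and> vfunctor X Y f"
  by (simp add: vfun_def)

lemma dist_vfun: "dist (vfun X Y) f g = (INF x\<in>objs X. dist Y (f x) (g x))"
  by (simp add: vfun_def)

lemma objs_discrete [simp]: "objs (discrete S) = S"
  by (simp add: discrete_def)

lemma vfunctor_mem: "vfunctor X Y f \<Longrightarrow> x \<in> objs X \<Longrightarrow> f x \<in> objs Y"
  by (auto simp: vfunctor_def)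

lemma vfunctor_dist:
  "vfunctor X Y f \<Longrightarrow> x' \<in> objs X \<Longrightarrow> x \<in> objs X \<Longrightarrow> dist X x' x \<le> dist Y (f x') (f x)"
  by (auto simp: vfunctor_def)

lemma vfunctor_discrete:
  "vcategory X \<Longrightarrow> vfunctor (discrete S) X f \<longleftrightarrow> f \<in> S \<rightarrow> objs X"
  by (auto simp: vfunctor_def discrete_def vcategory_def)

lemma vfunctor_compose:
  assumes "vfunctor X Y f" "vfunctor Y Z g"
  shows "vfunctor X Z (compose (objs X) g f)"
  using assms unfolding vfunctor_def compose_def
  by (auto simp: Pi_iff) (meson order_trans)

text \<open>The definition reads \<open>\<xi>\<close> only at objects of \<open>K\<close>. Hence the
  cylinder prescribed by \<open>left_kan_extension\<close> may be exchanged for a simpler formula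
  agreeing with it there.\<close>

lemma weighted_colimit_cong:
  fixes \<xi> :: "'k \<Rightarrow> 'w \<Rightarrow> 'u \<Rightarrow> 'u"
  assumes "\<And>k. k \<in> EOb K \<Longrightarrow> \<xi> k = \<xi>' k" "weighted_colimit K W small G Z \<xi>"
  shows "weighted_colimit K W small G Z \<xi>'"
proof -
  have "(\<lambda>k\<in>EOb K. \<lambda>w\<in>objs (FOb W k). compose (objs (FOb G k)) f (\<xi> k w)) =
      (\<lambda>k\<in>EOb K. \<lambda>w\<in>objs (FOb W k). compose (objs (FOb G k)) f (\<xi>' k w))" for f :: "'u \<Rightarrow> 'u"
    using assms(1) by (intro ext) (simp add: restrict_def)
  moreover have "vcat_nat (opposite K) W F \<xi> = vcat_nat (opposite K) W F \<xi>'" for F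
    using assms(1) by (simp add: vcat_nat_def opposite_def)
  ultimately show ?thesis
    using assms(2) by (simp add: weighted_colimit_def)
qed

section \<open>Composition and representables in V-cat-categories\<close>

lemma vcat_category_opposite:
  assumes "vcat_category K"
  shows "vcat_category (opposite K)"
proof -
  have "vfunctor (tensor (EHom K c b) (EHom K b a)) (EHom K c a) (\<lambda>(g, f). EComp K c b a f g)"
    if "a \<in> EOb K" "b \<in> EOb K" "c \<in> EOb K" for a b c
  proof -
    have "vfunctor (tensor (EHom K b a) (EHom K c b)) (EHom K c a) (\<lambda>(g, f). EComp K c b a g f)"
      using assms that by (auto simp: vcat_category_def)
    then show ?thesis
      by (auto simp: vfunctor_def tensor_def mult.commute Pi_iff)
  qed
  then show ?thesis
    using assms unfolding vcat_category_def opposite_def by simp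
qed

lemma vcat_category_EComp:
  assumes "vcat_category K" "a \<in> EOb K" "b \<in> EOb K" "c \<in> EOb K"
    and "f \<in> objs (EHom K a b)" "g \<in> objs (EHom K b c)"
  shows "EComp K a b c g f \<in> objs (EHom K a c)"
proof -
  have "vfunctor (tensor (EHom K b c) (EHom K a b)) (EHom K a c) (\<lambda>(g, f). EComp K a b c g f)"
    using assms by (auto simp: vcat_category_def)
  from vfunctor_mem[OF this, of "(g, f)"] show ?thesis
    using assms by (simp add: tensor_def)
qed

lemma vcat_category_EComp_dist:
  assumes "vcat_category K" "a \<in> EOb K" "b \<in> EOb K" "c \<in> EOb K"
    and "f \<in> objs (EHom K a b)" "g \<in> objs (EHom K b c)"
    and "f' \<in> objs (EHom K a b)" "g' \<in> objs (EHom K b c)"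
  shows "dist (EHom K b c) g g' * dist (EHom K a b) f f'
    \<le> dist (EHom K a c) (EComp K a b c g f) (EComp K a b c g' f')"
proof -
  have "vfunctor (tensor (EHom K b c) (EHom K a b)) (EHom K a c) (\<lambda>(g, f). EComp K a b c g f)"
    using assms by (auto simp: vcat_category_def)
  then show ?thesis
    using assms by (auto simp: vfunctor_def tensor_def)
qed

lemma vcat_category_assoc:
  assumes "vcat_category K" "a \<in> EOb K" "b \<in> EOb K" "c \<in> EOb K" "d \<in> EOb K"
    and "f \<in> objs (EHom K a b)" "g \<in> objs (EHom K b c)" "h \<in> objs (EHom K c d)"
  shows "EComp K a c d h (EComp K a b c g f) = EComp K a b d (EComp K b c d h g) f"
  using assms unfolding vcat_category_def by blast

lemma vcat_category_right_id:
  assumes "vcat_category K" "a \<in> EOb K" "b \<in> EOb K" "f \<in> objs (EHom K a b)"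
  shows "EComp K a a b f (EId K a) = f"
  using assms unfolding vcat_category_def by blast

lemma vcat_functor_EComp:
  assumes "vcat_functor A B F" "a \<in> EOb A" "b \<in> EOb A" "c \<in> EOb A"
    and "f \<in> objs (EHom A a b)" "g \<in> objs (EHom A b c)"
  shows "FMor F a c (EComp A a b c g f) =
    EComp B (FOb F a) (FOb F b) (FOb F c) (FMor F b c g) (FMor F a b f)"
  using assms unfolding vcat_functor_def by blast

text \<open>This makes \<open>V-cat(D-, X)\<close> a legitimate weight. Composition in
  \<open>C\<close> is a V-functor of two variables; fixing one of them costs nothing, because its
  self-distance is at least \<open>1\<close>. So precomposition is a V-functor in the precomposed
  arrow (\<open>pre\<close>) and in the arrow of \<open>K\<close> (\<open>nat\<close>).\<close>

lemma vcat_functor_hom_into: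
  fixes C :: "('p, 'n, 'v::comm_quantale) ecat"
  assumes G: "vcat_functor K C G" and Y: "Y \<in> EOb C"
  shows "vcat_functor (opposite K) VCAT (hom_into C G Y)"
proof -
  have K: "vcat_category K" and C: "vcat_category C"
    using G by (auto simp: vcat_functor_def)
  have GOb: "FOb G k \<in> EOb C" if "k \<in> EOb K" for k
    using G that by (auto simp: vcat_functor_def)
  have Gfun: "vfunctor (EHom K k l) (EHom C (FOb G k) (FOb G l)) (FMor G k l)"
    if "k \<in> EOb K" "l \<in> EOb K" for k l
    using G that by (auto simp: vcat_functor_def)
  have cat: "vcategory (EHom C a b)" if "a \<in> EOb C" "b \<in> EOb C" for a b
    using C that by (auto simp: vcat_category_def)
  have one_le: "1 \<le> dist (EHom C a b) f f"
    if "a \<in> EOb C" "b \<in> EOb C" "f \<in> objs (EHom C a b)" for a b f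
    using cat that by (auto intro: vcategory_id)
  let ?R = "\<lambda>k l h. \<lambda>f\<in>objs (EHom C (FOb G k) Y). EComp C (FOb G l) (FOb G k) Y f (FMor G l k h)"
  have pre: "vfunctor (EHom C (FOb G k) Y) (EHom C (FOb G l) Y) (?R k l h)"
    if k: "k \<in> EOb K" and l: "l \<in> EOb K" and h: "h \<in> objs (EHom K l k)" for k l h
    unfolding vfunctor_def
  proof (intro conjI ballI)
    have Gh: "FMor G l k h \<in> objs (EHom C (FOb G l) (FOb G k))"
      using Gfun[OF l k] h by (rule vfunctor_mem)
    show "?R k l h \<in> objs (EHom C (FOb G k) Y) \<rightarrow> objs (EHom C (FOb G l) Y)"
      using vcat_category_EComp[OF C GOb[OF l] GOb[OF k] Y Gh] by auto
    fix f' f assume f: "f' \<in> objs (EHom C (FOb G k) Y)" "f \<in> objs (EHom C (FOb G k) Y)"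
    have "dist (EHom C (FOb G k) Y) f' f
      \<le> dist (EHom C (FOb G k) Y) f' f * dist (EHom C (FOb G l) (FOb G k)) (FMor G l k h) (FMor G l k h)"
      by (rule quantale_le_mult(2)[OF one_le[OF GOb[OF l] GOb[OF k] Gh] order_refl])
    also have "\<dots> \<le> dist (EHom C (FOb G l) Y) (?R k l h f') (?R k l h f)"
      using vcat_category_EComp_dist[OF C GOb[OF l] GOb[OF k] Y Gh f(1) Gh f(2)] f by simp
    finally show "dist (EHom C (FOb G k) Y) f' f \<le> dist (EHom C (FOb G l) Y) (?R k l h f') (?R k l h f)" .
  qed
  have nat: "vfunctor (EHom K l k) (vfun (EHom C (FOb G k) Y) (EHom C (FOb G l) Y)) (?R k l)"
    if k: "k \<in> EOb K" and l: "l \<in> EOb K" for k l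
    unfolding vfunctor_def
  proof (intro conjI ballI)
    show "?R k l \<in> objs (EHom K l k) \<rightarrow> objs (vfun (EHom C (FOb G k) Y) (EHom C (FOb G l) Y))"
      using pre[OF k l] by auto
    fix h' h assume h: "h' \<in> objs (EHom K l k)" "h \<in> objs (EHom K l k)"
    have Gh: "FMor G l k h \<in> objs (EHom C (FOb G l) (FOb G k))"
      "FMor G l k h' \<in> objs (EHom C (FOb G l) (FOb G k))"
      using Gfun[OF l k] h by (auto intro: vfunctor_mem)
    have "dist (EHom K l k) h' h \<le> dist (EHom C (FOb G l) Y) (?R k l h' f) (?R k l h f)"
      if f: "f \<in> objs (EHom C (FOb G k) Y)" for f
    proof -
      have "dist (EHom K l k) h' h
        \<le> dist (EHom C (FOb G k) Y) f f * dist (EHom C (FOb G l) (FOb G k)) (FMor G l k h') (FMor G l k h)"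
        by (rule quantale_le_mult(1)[OF one_le[OF GOb[OF k] Y f] vfunctor_dist[OF Gfun[OF l k] h]])
      also have "\<dots> \<le> dist (EHom C (FOb G l) Y) (?R k l h' f) (?R k l h f)"
        using vcat_category_EComp_dist[OF C GOb[OF l] GOb[OF k] Y Gh(2) f Gh(1) f] f by simp
      finally show ?thesis .
    qed
    then show "dist (EHom K l k) h' h
      \<le> dist (vfun (EHom C (FOb G k) Y) (EHom C (FOb G l) Y)) (?R k l h') (?R k l h)"
      unfolding dist_vfun by (auto intro!: INF_greatest)
  qed
  show ?thesis
    unfolding vcat_functor_def
  proof (intro conjI ballI)
    show "vcat_category (opposite K)" by (rule vcat_category_opposite[OF K])
    show "vcat_category VCAT" by (rule vcat_category_VCat)
    fix a assume "a \<in> EOb (opposite K)"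
    then have a: "a \<in> EOb K" by (simp add: opposite_def)
    show "FOb (hom_into C G Y) a \<in> EOb VCAT"
      using cat[OF GOb[OF a] Y] by (simp add: hom_into_def VCat_def)
    have "EComp C (FOb G a) (FOb G a) Y f (FMor G a a (EId K a)) = f"
      if "f \<in> objs (EHom C (FOb G a) Y)" for f
    proof -
      have "FMor G a a (EId K a) = EId C (FOb G a)"
        using G a by (simp add: vcat_functor_def)
      then show ?thesis
        using vcat_category_right_id[OF C GOb[OF a] Y that] by simp
    qed
    then show "FMor (hom_into C G Y) a a (EId (opposite K) a) = EId VCAT (FOb (hom_into C G Y) a)"
      by (auto simp: hom_into_def opposite_def VCat_def restrict_def)
    fix b assume "b \<in> EOb (opposite K)"
    then have b: "b \<in> EOb K" by (simp add: opposite_def)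
    show "vfunctor (EHom (opposite K) a b)
        (EHom VCAT (FOb (hom_into C G Y) a) (FOb (hom_into C G Y) b)) (FMor (hom_into C G Y) a b)"
      using nat[OF a b] by (simp add: hom_into_def opposite_def VCat_def)
    fix c f g
    assume "c \<in> EOb (opposite K)" "f \<in> objs (EHom (opposite K) a b)" "g \<in> objs (EHom (opposite K) b c)"
    then have c: "c \<in> EOb K" and f: "f \<in> objs (EHom K b a)" and g: "g \<in> objs (EHom K c b)"
      by (simp_all add: opposite_def)
    have Gf: "FMor G b a f \<in> objs (EHom C (FOb G b) (FOb G a))"
      using Gfun[OF b a] f by (rule vfunctor_mem)
    have Gg: "FMor G c b g \<in> objs (EHom C (FOb G c) (FOb G b))"
      using Gfun[OF c b] g by (rule vfunctor_mem)
    have "FMor G c a (EComp K c b a f g) =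
        EComp C (FOb G c) (FOb G b) (FOb G a) (FMor G b a f) (FMor G c b g)"
      by (rule vcat_functor_EComp[OF G c b a g f])
    then have "EComp C (FOb G c) (FOb G a) Y u (FMor G c a (EComp K c b a f g)) =
        EComp C (FOb G c) (FOb G b) Y (EComp C (FOb G b) (FOb G a) Y u (FMor G b a f)) (FMor G c b g)"
      if "u \<in> objs (EHom C (FOb G a) Y)" for u
      using vcat_category_assoc[OF C GOb[OF c] GOb[OF b] GOb[OF a] Y Gg Gf that] by simp
    moreover have "EComp C (FOb G b) (FOb G a) Y u (FMor G b a f) \<in> objs (EHom C (FOb G b) Y)"
      if "u \<in> objs (EHom C (FOb G a) Y)" for u
      by (rule vcat_category_EComp[OF C GOb[OF b] GOb[OF a] Y Gf that])
    ultimately show "FMor (hom_into C G Y) a c (EComp (opposite K) a b c g f) =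
        EComp VCAT (FOb (hom_into C G Y) a) (FOb (hom_into C G Y) b) (FOb (hom_into C G Y) c)
          (FMor (hom_into C G Y) b c g) (FMor (hom_into C G Y) a b f)"
      by (auto simp: hom_into_def opposite_def VCat_def compose_def restrict_def)
  qed
qed

section \<open>Forcing lower bounds on distances\<close>

text \<open>In \<open>adjoin X E\<close> the distances of \<open>X\<close> are increased just enough to make \<open>r\<close> a lower bound
  for the distance from \<open>b\<close> to \<open>p\<close> whenever \<open>E r b p\<close>.\<close>

inductive path_weight ::
  "('o, 'v::comm_quantale) vcat \<Rightarrow> ('v \<Rightarrow> 'o \<Rightarrow> 'o \<Rightarrow> bool) \<Rightarrow> 'o \<Rightarrow> 'o \<Rightarrow> 'v \<Rightarrow> bool"
  for X E a where
  direct: "b \<in> objs X \<Longrightarrow> path_weight X E a b (dist X a b)"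
| extend: "path_weight X E a b v \<Longrightarrow> E r b p \<Longrightarrow> p \<in> objs X \<Longrightarrow> c \<in> objs X
    \<Longrightarrow> path_weight X E a c (v * (r * dist X p c))"

definition adjoin ::
  "('o, 'v::comm_quantale) vcat \<Rightarrow> ('v \<Rightarrow> 'o \<Rightarrow> 'o \<Rightarrow> bool) \<Rightarrow> ('o, 'v) vcat" where
  "adjoin X E = \<lparr>objs = objs X, dist = (\<lambda>a b. Sup {v. path_weight X E a b v})\<rparr>"

lemma objs_adjoin [simp]: "objs (adjoin X E) = objs X"
  by (simp add: adjoin_def)

lemma path_weight_le_dist: "path_weight X E a b v \<Longrightarrow> v \<le> dist (adjoin X E) a b"
  by (auto simp: adjoin_def intro: Sup_upper)

lemma dist_le_adjoin: "b \<in> objs X \<Longrightarrow> dist X a b \<le> dist (adjoin X E) a b"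
  by (intro path_weight_le_dist direct)

lemma adjoin_forces:
  assumes X: "vcategory X" and ab: "a \<in> objs X" "b \<in> objs X" and E: "E r a b"
  shows "r \<le> dist (adjoin X E) a b"
proof -
  have "r \<le> dist X a a * (r * dist X b b)"
    by (intro quantale_le_mult vcategory_id[OF X] ab order_refl)
  also have "\<dots> \<le> dist (adjoin X E) a b"
    by (intro path_weight_le_dist extend[OF direct] E ab)
  finally show ?thesis .
qed

text \<open>Concatenation leaves two consecutive distances meeting at \<open>b\<close>, which the
  triangle inequality in \<open>X\<close> merges into one. The merged path can weigh more than the
  product, so only an inequality is available.\<close>

lemma path_weight_trans:
  assumes X: "vcategory X" and a: "a \<in> objs X" and b: "b \<in> objs X" and v: "path_weight X E a b v"
    and w: "path_weight X E b c w"
  shows "\<exists>u. path_weight X E a c u \<and> v * w \<le> u"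
  using w
proof induction
  case (direct c)
  \<comment> \<open>The second path is a bare distance from \<open>b\<close>. It merges with the
    last distance of the first path, whose position depends on whether that path has any
    steps.\<close>
  from v show ?case
  proof cases
    case *: direct
    have "dist X a b * dist X b c \<le> dist X a c"
      using vcategory_comp[OF X a b direct] by (simp add: mult.commute)
    with * direct show ?thesis
      by (auto intro: path_weight.direct)
  next
    case (extend b' v' r p)
    have "dist X p b * dist X b c \<le> dist X p c"
      using vcategory_comp[OF X extend(4) b direct] by (simp add: mult.commute)
    then have "v * dist X b c \<le> v' * (r * dist X p c)"
      unfolding extend(1) mult.assoc by (intro quantale_mult_mono order_refl)
    with extend direct show ?thesis
      by (blast intro: path_weight.extend)
  qed
next
  case (extend b' w r p c)
  then obtain u where u: "path_weight X E a b' u" "v * w \<le> u" by blast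
  then have "v * (w * (r * dist X p c)) \<le> u * (r * dist X p c)"
    unfolding mult.assoc[of v, symmetric] by (intro quantale_mult_mono order_refl)
  with u(1) extend show ?case
    by (blast intro: path_weight.extend)
qed

text \<open>The triangle inequality is concatenation of paths, carried through the two suprema
  because the tensor preserves them in each variable.\<close>

lemma vcategory_adjoin:
  assumes X: "vcategory X"
  shows "vcategory (adjoin X E)"
  unfolding vcategory_def
proof (intro conjI ballI)
  fix c assume c: "c \<in> objs (adjoin X E)"
  then show "1 \<le> dist (adjoin X E) c c"
    using vcategory_id[OF X] dist_le_adjoin[of c X c E] by (auto intro: order_trans)
  fix b a assume ab: "b \<in> objs (adjoin X E)" "a \<in> objs (adjoin X E)"
  have "w * v \<le> dist (adjoin X E) a c" if "path_weight X E a b v" "path_weight X E b c w" for v w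
    using path_weight_trans[OF X _ _ that] ab path_weight_le_dist
    by (fastforce simp: mult.commute intro: order_trans)
  then have "Sup {w. path_weight X E b c w} * Sup {v. path_weight X E a b v} \<le> dist (adjoin X E) a c"
    by (intro quantale_Sup_mult_Sup_le) auto
  then show "dist (adjoin X E) b c * dist (adjoin X E) a b \<le> dist (adjoin X E) a c"
    by (simp add: adjoin_def)
qed

text \<open>This is the universal property of \<open>adjoin\<close>: the triangle inequality in
  \<open>Y\<close> along the image of a path bounds its weight, hence the supremum of all
  weights.\<close>

lemma vfunctor_adjoin:
  assumes Y: "vcategory Y" and f: "vfunctor X Y f"
    and E: "\<And>r a b. a \<in> objs X \<Longrightarrow> b \<in> objs X \<Longrightarrow> E r a b \<Longrightarrow> r \<le> dist Y (f a) (f b)"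
  shows "vfunctor (adjoin X E) Y f"
proof -
  \<comment> \<open>Membership of the endpoint is carried along, since the hypothesis on
    \<open>E\<close> speaks of objects of \<open>X\<close> only, and an extending step assumes
    membership just of \<open>p\<close> and \<open>c\<close>.\<close>
  have "b \<in> objs X \<and> v \<le> dist Y (f a) (f b)" if "path_weight X E a b v" and a: "a \<in> objs X" for a b v
    using that(1)
  proof induction
    case (direct b)
    with f a show ?case by (auto intro: vfunctor_dist)
  next
    case (extend b v r p c)
    have mem: "f a \<in> objs Y" "f b \<in> objs Y" "f p \<in> objs Y" "f c \<in> objs Y"
      using f a extend by (auto intro: vfunctor_mem)
    have "v * (r * dist X p c) \<le> dist Y (f a) (f b) * (dist Y (f b) (f p) * dist Y (f p) (f c))"
      using extend E f by (intro quantale_mult_mono) (auto intro: vfunctor_dist)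
    also have "\<dots> \<le> dist Y (f a) (f b) * dist Y (f b) (f c)"
      using vcategory_comp[OF Y mem(2-4)]
      by (intro quantale_mult_mono order_refl) (simp add: mult.commute)
    also have "\<dots> \<le> dist Y (f a) (f c)"
      using vcategory_comp[OF Y mem(1,2,4)] by (simp add: mult.commute)
    finally show ?case using extend by simp
  qed
  then show ?thesis
    using f by (auto simp: vfunctor_def adjoin_def intro!: Sup_least)
qed

lemma vfunctor_from_adjoin:
  assumes "vfunctor (adjoin X E) Y f"
  shows "vfunctor X Y f"
  using assms unfolding vfunctor_def
  by (auto intro: order_trans[OF dist_le_adjoin])

section \<open>The extension of a functor from sets\<close>

locale set_functor =
  fixes small :: "'u set \<Rightarrow> bool"
    and pair :: "'u \<times> 'u \<Rightarrow> 'u"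
    and H :: "('u set, 'u \<Rightarrow> 'u, ('u, 'v::comm_quantale) vcat, 'u \<Rightarrow> 'u) efunctor"
  assumes universe: "set_universe small pair"
    and functorial: "vcat_functor (SetC small) (VCat small) H"
begin

text \<open>The distances of the homs of \<open>SetC small\<close> live in a type that has to be fixed.\<close>

abbreviation SetV :: "('u set, 'u \<Rightarrow> 'u, 'v) ecat" where
  "SetV \<equiv> SetC small"

lemma H_Ob:
  assumes "small S"
  shows "vcategory (FOb H S)" "small (objs (FOb H S))"
  using functorial assms by (auto simp: vcat_functor_def SetC_def VCat_def)

lemma H_Mor:
  assumes "small S" "small T" "f \<in> S \<rightarrow>\<^sub>E T"
  shows "FMor H S T f \<in> extensional (objs (FOb H S))" "vfunctor (FOb H S) (FOb H T) (FMor H S T f)"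
proof -
  have "vfunctor (discrete (S \<rightarrow>\<^sub>E T)) (vfun (FOb H S) (FOb H T)) (FMor H S T)"
    using functorial assms by (auto simp: vcat_functor_def SetC_def VCat_def)
  from vfunctor_mem[OF this] assms
  show "FMor H S T f \<in> extensional (objs (FOb H S))" "vfunctor (FOb H S) (FOb H T) (FMor H S T f)"
    by simp_all
qed

lemma H_Mor_mem:
  "small S \<Longrightarrow> small T \<Longrightarrow> f \<in> S \<rightarrow>\<^sub>E T \<Longrightarrow> B \<in> objs (FOb H S) \<Longrightarrow> FMor H S T f B \<in> objs (FOb H T)"
  using H_Mor(2) vfunctor_mem by fast

lemma H_id: "small S \<Longrightarrow> FMor H S S (\<lambda>x\<in>S. x) = (\<lambda>B\<in>objs (FOb H S). B)"
  using functorial by (auto simp: vcat_functor_def SetC_def VCat_def)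

lemma H_compose:
  assumes "small R" "small S" "small T" "f \<in> R \<rightarrow>\<^sub>E S" "g \<in> S \<rightarrow>\<^sub>E T"
  shows "FMor H R T (compose R g f) = compose (objs (FOb H R)) (FMor H S T g) (FMor H R S f)"
  using functorial assms by (auto simp: vcat_functor_def SetC_def VCat_def)

lemma small_threshold:
  assumes "small (objs X)"
  shows "small (threshold pair X r)"
proof -
  have "small (pair ` (objs X \<times> objs X))"
    using universe assms unfolding set_universe_def by blast
  moreover have "threshold pair X r \<subseteq> pair ` (objs X \<times> objs X)"
    unfolding threshold_def by blast
  ultimately show ?thesis
    using universe unfolding set_universe_def by blast
qed

lemma inv_pair [simp]: "inv pair (pair p) = p"
  using universe by (simp add: set_universe_def)

lemma d_mem:
  "d0 pair X r \<in> threshold pair X r \<rightarrow>\<^sub>E objs X" "d1 pair X r \<in> threshold pair X r \<rightarrow>\<^sub>E objs X"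
  by (auto simp: d0_def d1_def threshold_def)

lemma le_dist_d:
  "p \<in> threshold pair X r \<Longrightarrow> r \<le> dist X (d0 pair X r p) (d1 pair X r p)"
  by (auto simp: d0_def d1_def threshold_def image_iff)

text \<open>Each object of \<open>H X_r\<close> forces one lower bound; collected as a relation,
  these bring the cocone condition into the form that \<open>adjoin\<close> treats.\<close>

definition link :: "('u, 'v) vcat \<Rightarrow> 'v \<Rightarrow> 'u \<Rightarrow> 'u \<Rightarrow> bool" where
  "link X r a b \<longleftrightarrow> (\<exists>C\<in>objs (FOb H (threshold pair X r)). Hd0 H pair X r C = a \<and> Hd1 H pair X r C = b)"

definition sharp :: "('u, 'v) vcat \<Rightarrow> ('u, 'v) vcat" where
  "sharp X = adjoin (FOb H (objs X)) (link X)"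

definition Lan :: "(('u, 'v) vcat, 'u \<Rightarrow> 'u, ('u, 'v) vcat, 'u \<Rightarrow> 'u) efunctor" where
  "Lan = \<lparr>FOb = sharp, FMor = (\<lambda>X Y. FMor H (objs X) (objs Y))\<rparr>"

text \<open>One family serves twice: at arbitrary \<open>X\<close> as the couniversal cocone, at
  \<open>discrete S\<close> as a component of the unit of the Kan extension. The restriction makes
  it extensional, as objects of \<open>vfun\<close> have to be.\<close>

definition kan_unit :: "('u, 'v) vcat \<Rightarrow> 'u \<Rightarrow> 'u" where
  "kan_unit X = (\<lambda>A\<in>objs (FOb H (objs X)). A)"

lemma objs_sharp [simp]: "objs (sharp X) = objs (FOb H (objs X))"
  by (simp add: sharp_def)

lemma Lan_simps [simp]: "FOb Lan X = sharp X" "FMor Lan X Y = FMor H (objs X) (objs Y)"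
  by (simp_all add: Lan_def)

lemma Hd_mem:
  assumes "small (objs X)" "C \<in> objs (FOb H (threshold pair X r))"
  shows "Hd0 H pair X r C \<in> objs (FOb H (objs X))" "Hd1 H pair X r C \<in> objs (FOb H (objs X))"
  unfolding Hd0_def Hd1_def using assms H_Mor_mem small_threshold d_mem by blast+

section \<open>The supremum formula for distances\<close>

text \<open>Inductively built weights and indexed products form the same set: extending a path by
  one step appends one factor to the product.\<close>

lemma dist_sharp_eq:
  assumes a: "a \<in> objs (FOb H (objs X))" and b: "b \<in> objs (FOb H (objs X))"
  shows "dist (sharp X) a b = Sup (path_values H pair X a b)"
proof -
  let ?A = "FOb H (objs X)"
  \<comment> \<open>The endpoint and the weight stay arguments because both change in the induction;
    the start \<open>a\<close> is fixed throughout.\<close>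
  define is_path where "is_path n P Q r b v \<longleftrightarrow>
      v = dist ?A (P 0) (Q 0) * (\<Prod>i=1..n. r i * dist ?A (P i) (Q i)) \<and>
      (\<forall>i\<le>n. P i \<in> objs ?A \<and> Q i \<in> objs ?A) \<and> P 0 = a \<and> Q n = b \<and>
      (\<forall>i\<in>{1..n}. link X (r i) (Q (i - 1)) (P i))" for n :: nat and P Q r b v
  have path_values: "path_values H pair X a b = {v. \<exists>n P Q r. is_path n P Q r b v}" for b
    unfolding path_values_def is_path_def link_def by (rule refl)
  have to_path: "\<exists>n P Q r. is_path n P Q r b v" if "path_weight ?A (link X) a b v" for b v
    using that
  proof induction
    case (direct b)
    \<comment> \<open>The product over \<open>{1..0}\<close> is empty, so any sequence of thresholds
      will do here.\<close>
    with a have "is_path 0 (\<lambda>_. a) (\<lambda>_. b) (\<lambda>_. 1) b (dist ?A a b)"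
      by (simp add: is_path_def)
    then show ?case by blast
  next
    case (extend b v s p c)
    then obtain n P Q r where "is_path n P Q r b v" by blast
    then have *: "v = dist ?A (P 0) (Q 0) * (\<Prod>i=1..n. r i * dist ?A (P i) (Q i))"
      "\<forall>i\<le>n. P i \<in> objs ?A \<and> Q i \<in> objs ?A" "P 0 = a" "Q n = b"
      "\<forall>i\<in>{1..n}. link X (r i) (Q (i - 1)) (P i)"
      by (simp_all add: is_path_def)
    \<comment> \<open>The new step is written at index \<open>Suc n\<close>, which leaves the
      indices up to \<open>n\<close>, and with them the earlier factors, untouched. Its link starts
      at \<open>Q n\<close>, the old endpoint.\<close>
    let ?P = "P(Suc n := p)" and ?Q = "Q(Suc n := c)" and ?r = "r(Suc n := s)"
    have "(\<Prod>i=1..n. ?r i * dist ?A (?P i) (?Q i)) = (\<Prod>i=1..n. r i * dist ?A (P i) (Q i))"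
      by (rule prod.cong) auto
    then have "(\<Prod>i=1..Suc n. ?r i * dist ?A (?P i) (?Q i)) =
        (\<Prod>i=1..n. r i * dist ?A (P i) (Q i)) * (s * dist ?A p c)"
      unfolding prod.cl_ivl_Suc by simp
    then have "v * (s * dist ?A p c) =
        dist ?A (?P 0) (?Q 0) * (\<Prod>i=1..Suc n. ?r i * dist ?A (?P i) (?Q i))"
      unfolding *(1) by (simp only: mult.assoc) simp
    moreover have "\<forall>i\<in>{1..Suc n}. link X (?r i) (?Q (i - 1)) (?P i)"
      using * extend by (auto simp: le_Suc_eq)
    moreover have "\<forall>i\<le>Suc n. ?P i \<in> objs ?A \<and> ?Q i \<in> objs ?A" "?P 0 = a" "?Q (Suc n) = c"
      using * extend by (auto simp: le_Suc_eq)
    ultimately have "is_path (Suc n) ?P ?Q ?r c (v * (s * dist ?A p c))"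
      unfolding is_path_def by blast
    then show ?case by blast
  qed
  \<comment> \<open>The induction runs over prefixes of length \<open>m \<le> n\<close>, so that the
    hypotheses on the whole path stay fixed.\<close>
  have of_path: "path_weight ?A (link X) (P 0) (Q m)
      (dist ?A (P 0) (Q 0) * (\<Prod>i=1..m. r i * dist ?A (P i) (Q i)))"
    if "\<forall>i\<le>n. P i \<in> objs ?A \<and> Q i \<in> objs ?A"
      and "\<forall>i\<in>{1..n}. link X (r i) (Q (i - 1)) (P i)" and "m \<le> n" for n m :: nat and P Q r
    using that(3)
  proof (induction m)
    case 0
    with that show ?case by (auto intro: direct)
  next
    case (Suc m)
    have "link X (r (Suc m)) (Q m) (P (Suc m))"
      using that(2)[rule_format, of "Suc m"] Suc.prems by simp
    then have "path_weight ?A (link X) (P 0) (Q (Suc m))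
      ((dist ?A (P 0) (Q 0) * (\<Prod>i=1..m. r i * dist ?A (P i) (Q i))) *
       (r (Suc m) * dist ?A (P (Suc m)) (Q (Suc m))))"
      using Suc that(1) by (intro extend) auto
    then show ?case by (simp add: mult.assoc)
  qed
  have "path_weight ?A (link X) a b v" if "is_path n P Q r b v" for n P Q r v
    using of_path[of n P Q r n] that by (simp add: is_path_def)
  with to_path have "{v. path_weight ?A (link X) a b v} = path_values H pair X a b"
    unfolding path_values by blast
  then show ?thesis
    by (simp add: sharp_def adjoin_def)
qed

section \<open>Cocones as V-functors out of \<open>sharp X\<close>\<close>

lemma sharp_Ob:
  assumes "vcategory X" "small (objs X)"
  shows "vcategory (sharp X)" "small (objs (sharp X))"
  using assms H_Ob by (auto simp: sharp_def intro: vcategory_adjoin)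

lemma dist_le_sharp:
  "b \<in> objs (FOb H (objs X)) \<Longrightarrow> dist (FOb H (objs X)) a b \<le> dist (sharp X) a b"
  unfolding sharp_def by (rule dist_le_adjoin)

lemma sharp_forces:
  assumes "small (objs X)" "C \<in> objs (FOb H (threshold pair X r))"
  shows "r \<le> dist (sharp X) (Hd0 H pair X r C) (Hd1 H pair X r C)"
  unfolding sharp_def using assms
  by (intro adjoin_forces H_Ob Hd_mem) (auto simp: link_def)

text \<open>The cocone inequalities are exactly what \<open>vfunctor_adjoin\<close> asks for the
  relation \<open>link X\<close>. Conversely, the lower bounds forced in \<open>sharp X\<close> are
  passed on to \<open>Y\<close> by any V-functor.\<close>

lemma cocone_iff:
  assumes X: "small (objs X)" and Y: "vcategory Y"
  shows "cocone H pair X Y f \<longleftrightarrow> f \<in> objs (vfun (sharp X) Y)"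
proof
  assume f: "cocone H pair X Y f"
  then have "r \<le> dist Y (f (Hd0 H pair X r C)) (f (Hd1 H pair X r C))"
    if "C \<in> objs (FOb H (threshold pair X r))" for r C
    using that by (auto simp: cocone_def le_INF_iff)
  with f have "vfunctor (sharp X) Y f"
    unfolding sharp_def by (intro vfunctor_adjoin Y) (auto simp: cocone_def link_def)
  with f show "f \<in> objs (vfun (sharp X) Y)"
    by (simp add: cocone_def)
next
  assume f: "f \<in> objs (vfun (sharp X) Y)"
  then have "r \<le> dist Y (f (Hd0 H pair X r C)) (f (Hd1 H pair X r C))"
    if "C \<in> objs (FOb H (threshold pair X r))" for r C
    using order_trans[OF sharp_forces[OF X that] vfunctor_dist[of "sharp X" Y f]] Hd_mem[OF X that]
    by simp
  moreover have "vfunctor (FOb H (objs X)) Y f"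
    using f by (auto simp: sharp_def intro: vfunctor_from_adjoin)
  ultimately show "cocone H pair X Y f"
    using f by (auto simp: cocone_def intro!: INF_greatest)
qed

text \<open>Two maps \<open>f\<close>, \<open>g\<close> into \<open>Y\<close> at pointwise distance at least \<open>r\<close> factor through the
  projections of the threshold set \<open>Y\<^sub>r\<close>.\<close>

lemma le_dist_sharp_H:
  assumes S: "small S" and Y: "small (objs Y)" and fg: "f \<in> S \<rightarrow>\<^sub>E objs Y" "g \<in> S \<rightarrow>\<^sub>E objs Y"
    and r: "\<And>x. x \<in> S \<Longrightarrow> r \<le> dist Y (f x) (g x)" and B: "B \<in> objs (FOb H S)"
  shows "r \<le> dist (sharp Y) (FMor H S (objs Y) f B) (FMor H S (objs Y) g B)"
proof -
  define h where "h = (\<lambda>x\<in>S. pair (f x, g x))"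
  let ?T = "threshold pair Y r"
  have h: "h \<in> S \<rightarrow>\<^sub>E ?T"
    using fg r by (auto simp: h_def threshold_def)
  then have mem: "h x \<in> ?T" if "x \<in> S" for x
    using that by auto
  have "compose S (d0 pair Y r) h = f" "compose S (d1 pair Y r) h = g"
    using fg mem by (auto simp: fun_eq_iff compose_def d0_def d1_def PiE_def extensional_def)
      (auto simp: h_def)
  \<comment> \<open>By functoriality, both images of \<open>B\<close> come from the single object
    \<open>FMor H S ?T h B\<close>, at which \<open>sharp Y\<close> forces the bound
    \<open>r\<close>.\<close>
  then have "FMor H S (objs Y) f B = Hd0 H pair Y r (FMor H S ?T h B)"
    "FMor H S (objs Y) g B = Hd1 H pair Y r (FMor H S ?T h B)"
    using H_compose[OF S small_threshold[OF Y] Y h d_mem(1)]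
      H_compose[OF S small_threshold[OF Y] Y h d_mem(2)] B
    by (simp_all add: Hd0_def Hd1_def compose_eq)
  then show ?thesis
    using sharp_forces[OF Y] H_Mor_mem[OF S small_threshold[OF Y] h B] by simp
qed

section \<open>Enriched functoriality of the extension\<close>

lemma vfunctor_H_sharp:
  assumes S: "small S" and X: "vcategory X" "small (objs X)" and g: "g \<in> S \<rightarrow>\<^sub>E objs X"
  shows "vfunctor (FOb H S) (sharp X) (FMor H S (objs X) g)"
proof -
  have "vfunctor (FOb H S) (FOb H (objs X)) (FMor H S (objs X) g)"
    using assms by (intro H_Mor)
  then show ?thesis
    using H_Mor_mem[OF S X(2) g] unfolding vfunctor_def
    by (auto intro: order_trans[OF _ dist_le_sharp])
qed

text \<open>It suffices that the image of \<open>f\<close> under \<open>H\<close> is a cocone.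
  Composing \<open>f\<close> with \<open>d0\<close> and \<open>d1\<close> yields two maps on
  \<open>X_r\<close> at pointwise distance at least \<open>r\<close>, to which
  \<open>le_dist_sharp_H\<close> applies.\<close>

lemma vfunctor_Lan:
  assumes X: "vcategory X" "small (objs X)" and Y: "vcategory Y" "small (objs Y)"
    and f: "f \<in> objs (vfun X Y)"
  shows "FMor H (objs X) (objs Y) f \<in> objs (vfun (sharp X) (sharp Y))"
proof -
  have fE: "f \<in> objs X \<rightarrow>\<^sub>E objs Y"
    using f by (auto simp: vfunctor_def PiE_def)
  have "r \<le> dist (sharp Y) (FMor H (objs X) (objs Y) f (Hd0 H pair X r C))
        (FMor H (objs X) (objs Y) f (Hd1 H pair X r C))"
    if C: "C \<in> objs (FOb H (threshold pair X r))" for r C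
  proof -
    let ?T = "threshold pair X r"
    have T: "small ?T" by (rule small_threshold[OF X(2)])
    have "FMor H (objs X) (objs Y) f (Hd0 H pair X r C) = FMor H ?T (objs Y) (compose ?T f (d0 pair X r)) C"
      "FMor H (objs X) (objs Y) f (Hd1 H pair X r C) = FMor H ?T (objs Y) (compose ?T f (d1 pair X r)) C"
      using H_compose[OF T X(2) Y(2) d_mem(1) fE] H_compose[OF T X(2) Y(2) d_mem(2) fE] C
      by (simp_all add: Hd0_def Hd1_def compose_eq)
    moreover have "r \<le> dist Y (f (d0 pair X r p)) (f (d1 pair X r p))" if p: "p \<in> ?T" for p
    proof -
      have "d0 pair X r p \<in> objs X" "d1 pair X r p \<in> objs X"
        using d_mem p by (metis PiE_mem)+
      then have "dist X (d0 pair X r p) (d1 pair X r p) \<le> dist Y (f (d0 pair X r p)) (f (d1 pair X r p))"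
        using f by (auto intro: vfunctor_dist)
      with le_dist_d[OF p] show ?thesis by (rule order_trans)
    qed
    moreover have "compose ?T f (d0 pair X r) \<in> ?T \<rightarrow>\<^sub>E objs Y" "compose ?T f (d1 pair X r) \<in> ?T \<rightarrow>\<^sub>E objs Y"
      using PiE_mem[OF d_mem(1), of _ X r] PiE_mem[OF d_mem(2), of _ X r] PiE_mem[OF fE]
      by (auto simp: compose_def)
    ultimately show ?thesis
      using le_dist_sharp_H[OF T Y(2) _ _ _ C] by (simp add: compose_eq)
  qed
  then have "cocone H pair X (sharp Y) (FMor H (objs X) (objs Y) f)"
    using vfunctor_H_sharp[OF X(2) Y fE] H_Mor(1)[OF X(2) Y(2) fE]
    by (auto simp: cocone_def intro!: INF_greatest)
  then show ?thesis
    using cocone_iff[OF X(2) sharp_Ob(1)[OF Y]] by simp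
qed

lemma vcat_functor_Lan: "vcat_functor (VCat small) (VCat small) Lan"
  unfolding vcat_functor_def
proof (intro conjI ballI)
  show "vcat_category (VCat small :: (('u, 'v) vcat, 'u \<Rightarrow> 'u, 'v) ecat)"
    "vcat_category (VCat small :: (('u, 'v) vcat, 'u \<Rightarrow> 'u, 'v) ecat)"
    by (rule vcat_category_VCat)+
  fix X :: "('u, 'v) vcat" assume "X \<in> EOb (VCat small)"
  then have X: "vcategory X" "small (objs X)" by (auto simp: VCat_def)
  show "FOb Lan X \<in> EOb (VCat small)"
    using sharp_Ob[OF X] by (simp add: VCat_def)
  show "FMor Lan X X (EId (VCat small) X) = EId (VCat small) (FOb Lan X)"
    using H_id[OF X(2)] by (simp add: VCat_def)
  fix Y :: "('u, 'v) vcat" assume "Y \<in> EOb (VCat small)"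
  then have Y: "vcategory Y" "small (objs Y)" by (auto simp: VCat_def)
  have E: "f \<in> objs X \<rightarrow>\<^sub>E objs Y" if "f \<in> objs (vfun X Y)" for f
    using that by (auto simp: vfunctor_def PiE_def)
  \<comment> \<open>The threshold is taken to be the distance of \<open>f\<close> and
    \<open>g\<close> itself, which lies below every pointwise distance.\<close>
  have "dist (vfun X Y) f g \<le> dist (vfun (sharp X) (sharp Y))
      (FMor H (objs X) (objs Y) f) (FMor H (objs X) (objs Y) g)"
    if f: "f \<in> objs (vfun X Y)" and g: "g \<in> objs (vfun X Y)" for f g
    unfolding dist_vfun objs_sharp
    by (intro INF_greatest le_dist_sharp_H X Y E f g INF_lower)
  then show "vfunctor (EHom (VCat small) X Y) (EHom (VCat small) (FOb Lan X) (FOb Lan Y)) (FMor Lan X Y)"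
    using vfunctor_Lan[OF X Y] by (auto simp: vfunctor_def[of "vfun _ _"] VCat_def simp del: mem_vfun)
  fix Z :: "('u, 'v) vcat" and f g
  assume "Z \<in> EOb (VCat small)" and "f \<in> objs (EHom (VCat small) X Y)"
    and "g \<in> objs (EHom (VCat small) Y Z)"
  then have "small (objs Z)" "f \<in> objs X \<rightarrow>\<^sub>E objs Y" "g \<in> objs Y \<rightarrow>\<^sub>E objs Z"
    by (auto simp: VCat_def vfunctor_def PiE_def)
  from H_compose[OF X(2) Y(2) this]
  show "FMor Lan X Z (EComp (VCat small) X Y Z g f) =
      EComp (VCat small) (FOb Lan X) (FOb Lan Y) (FOb Lan Z) (FMor Lan Y Z g) (FMor Lan X Y f)"
    by (simp add: VCat_def)
qed

lemma kan_unit_natural: "vcat_nat SetV H (efunctor_comp Lan Disc) (\<lambda>S. kan_unit (discrete S))"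
proof -
  have "vfunctor (FOb H S) (sharp (discrete S)) (kan_unit (discrete S))" for S
    using dist_le_sharp[of _ "discrete S"] by (auto simp: vfunctor_def kan_unit_def)
  then show ?thesis
    using H_Mor_mem
    by (auto simp: vcat_nat_def SetC_def efunctor_comp_def Disc_def kan_unit_def discrete_def[of "_ \<rightarrow>\<^sub>E _"])
qed

section \<open>The universal property as a weighted colimit\<close>

lemma weight_eq:
  assumes "vcategory X"
  shows "objs (vfun (discrete S) X) = S \<rightarrow>\<^sub>E objs X"
  by (auto simp: PiE_def vfunctor_discrete[OF assms])

text \<open>On underlying sets the weight is represented by \<open>objs X\<close>, so a Yoneda
  argument recovers a transformation from its value at the identity. Its V-functoriality at
  \<open>d0\<close> and \<open>d1\<close> makes that value a cocone.\<close>

lemma weighted_colimit_sharp: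
  assumes "vcategory X" "small (objs X)"
  shows "weighted_colimit SetV (hom_into (VCat small) Disc X) small H (sharp X)
    (\<lambda>S. \<lambda>g\<in>objs (vfun (discrete S) X). FMor H S (objs X) g)"
proof -
  note X = assms
  let ?W = "hom_into (VCat small) Disc X"
  let ?xi = "\<lambda>S. \<lambda>g\<in>objs (vfun (discrete S) X). FMor H S (objs X) g"
  let ?id = "\<lambda>x\<in>objs X. x"
  note weight = weight_eq[OF X(1)]
  have W_Ob: "FOb ?W S = vfun (discrete S) X" for S
    by (simp add: hom_into_def VCat_def Disc_def)
  \<comment> \<open>\<open>hom_into\<close> precomposes only on genuine homs, hence the guard on
    \<open>\<alpha> S g\<close>; the first conjunct supplies it.\<close>
  have nat_iff: "vcat_nat (opposite SetV) ?W (hom_into (VCat small) H Y) \<alpha> \<longleftrightarrow>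
      (\<forall>S. small S \<longrightarrow> \<alpha> S \<in> objs (vfun (vfun (discrete S) X) (vfun (FOb H S) Y))) \<and>
      (\<forall>S T. small S \<longrightarrow> small T \<longrightarrow> (\<forall>h\<in>T \<rightarrow>\<^sub>E S. \<forall>g\<in>S \<rightarrow>\<^sub>E objs X. \<alpha> S g \<in> objs (vfun (FOb H S) Y) \<longrightarrow>
        \<alpha> T (compose T g h) = compose (objs (FOb H T)) (\<alpha> S g) (FMor H T S h)))"
    for Y :: "('u, 'v) vcat" and \<alpha>
  proof -
    have "\<alpha> S g \<in> objs (vfun (FOb H S) Y)"
      if "\<alpha> S \<in> objs (vfun (vfun (discrete S) X) (vfun (FOb H S) Y))" "g \<in> S \<rightarrow>\<^sub>E objs X" for S g
      using that weight[of S] vfunctor_mem[of "vfun (discrete S) X" "vfun (FOb H S) Y" "\<alpha> S" g]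
      by simp
    then show ?thesis
      unfolding vcat_nat_def W_Ob weight
      by (auto simp: opposite_def SetC_def hom_into_def VCat_def Disc_def weight simp del: mem_vfun)
  qed
  \<comment> \<open>Taking for the threshold the distance of \<open>g\<close> and \<open>g'\<close>
    in the weight shows that the cylinder is V-functorial in its weight argument.\<close>
  have xi_dist: "dist (vfun (discrete S) X) g g' \<le> dist Y (f (FMor H S (objs X) g B)) (f (FMor H S (objs X) g' B))"
    if S: "small S" and g: "g \<in> S \<rightarrow>\<^sub>E objs X" "g' \<in> S \<rightarrow>\<^sub>E objs X" and f: "vfunctor (sharp X) Y f"
      and B: "B \<in> objs (FOb H S)" for S g g' B f and Y :: "('u, 'v) vcat"
  proof -
    have "dist (vfun (discrete S) X) g g' \<le> dist (sharp X) (FMor H S (objs X) g B) (FMor H S (objs X) g' B)"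
      by (intro le_dist_sharp_H S X g B) (auto simp: dist_vfun intro: INF_lower)
    also have "\<dots> \<le> dist Y (f (FMor H S (objs X) g B)) (f (FMor H S (objs X) g' B))"
      using f H_Mor_mem[OF S X(2) _ B] g by (auto intro: vfunctor_dist)
    finally show ?thesis .
  qed
  \<comment> \<open>The comparison map of \<open>weighted_colimit\<close>, kept in the very form it
    has there so that unfolding matches at the end.\<close>
  define \<Phi> :: "('u \<Rightarrow> 'u) \<Rightarrow> 'u set \<Rightarrow> ('u \<Rightarrow> 'u) \<Rightarrow> 'u \<Rightarrow> 'u" where
    "\<Phi> = (\<lambda>f. \<lambda>S\<in>EOb SetV. \<lambda>g\<in>objs (FOb ?W S). compose (objs (FOb H S)) f (?xi S g))"
  have \<Phi>_apply: "\<Phi> f S g = compose (objs (FOb H S)) f (FMor H S (objs X) g)"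
    if "small S" "g \<in> S \<rightarrow>\<^sub>E objs X" for f S g
    using that by (simp add: \<Phi>_def SetC_def W_Ob weight del: mem_vfun)
  have \<Phi>_nat: "vcat_nat (opposite SetV) ?W (hom_into (VCat small) H Y) (\<Phi> f)"
    if Y: "vcategory Y" and f: "vfunctor (sharp X) Y f" for f and Y :: "('u, 'v) vcat"
    unfolding nat_iff
  proof (intro conjI allI impI ballI)
    fix S assume S: "small S"
    have "compose (objs (FOb H S)) f (FMor H S (objs X) g) \<in> objs (vfun (FOb H S) Y)"
      if "g \<in> S \<rightarrow>\<^sub>E objs X" for g
      using vfunctor_compose[OF vfunctor_H_sharp[OF S X that] f] by simp
    moreover have "dist (vfun (discrete S) X) g g' \<le> dist (vfun (FOb H S) Y)
        (compose (objs (FOb H S)) f (FMor H S (objs X) g))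
        (compose (objs (FOb H S)) f (FMor H S (objs X) g'))"
      if "g \<in> S \<rightarrow>\<^sub>E objs X" "g' \<in> S \<rightarrow>\<^sub>E objs X" for g g'
      unfolding dist_vfun[of "FOb H S"] using xi_dist[OF S that f]
      by (intro INF_greatest) (simp add: compose_eq)
    moreover have "\<Phi> f S \<in> extensional (objs (vfun (discrete S) X))"
      using S by (simp add: \<Phi>_def SetC_def W_Ob)
    ultimately show "\<Phi> f S \<in> objs (vfun (vfun (discrete S) X) (vfun (FOb H S) Y))"
      unfolding mem_vfun[of _ "vfun _ _"] vfunctor_def[of "vfun _ _"] weight
      using \<Phi>_apply[OF S] by (auto simp del: mem_vfun)
  next
    fix S T h g
    assume S: "small S" and T: "small T" and h: "h \<in> T \<rightarrow>\<^sub>E S" and g: "g \<in> S \<rightarrow>\<^sub>E objs X"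
    have "compose T g h \<in> T \<rightarrow>\<^sub>E objs X"
      using g h by (auto simp: compose_def)
    then show "\<Phi> f T (compose T g h) = compose (objs (FOb H T)) (\<Phi> f S g) (FMor H T S h)"
      using \<Phi>_apply[OF T] \<Phi>_apply[OF S g] H_compose[OF T S X(2) h g] H_Mor_mem[OF T S h]
      by (auto simp: compose_def fun_eq_iff)
  qed
  have id: "?id \<in> objs X \<rightarrow>\<^sub>E objs X" by auto
  have \<Phi>_id: "\<Phi> f (objs X) ?id = f" if "f \<in> objs (vfun (sharp X) Y)" for f and Y :: "('u, 'v) vcat"
    using \<Phi>_apply[OF X(2) id, of f] H_id[OF X(2)] that
    by (auto simp: compose_def fun_eq_iff extensional_def)
  have \<alpha>_id: "\<alpha> (objs X) ?id \<in> objs (vfun (sharp X) Y)" "\<Phi> (\<alpha> (objs X) ?id) = \<alpha>"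
    if Y: "vcategory Y" and \<alpha>: "\<alpha> \<in> extensional (EOb SetV)"
      and nat: "vcat_nat (opposite SetV) ?W (hom_into (VCat small) H Y) \<alpha>" for \<alpha> and Y :: "('u, 'v) vcat"
  proof -
    have vf: "\<alpha> S \<in> objs (vfun (vfun (discrete S) X) (vfun (FOb H S) Y))" if "small S" for S
      using nat that unfolding nat_iff by blast
    have val: "\<alpha> S g \<in> objs (vfun (FOb H S) Y)" if "small S" "g \<in> S \<rightarrow>\<^sub>E objs X" for S g
      using vf[OF that(1)] that(2) weight[of S]
        vfunctor_mem[of "vfun (discrete S) X" "vfun (FOb H S) Y" "\<alpha> S" g] by simp
    \<comment> \<open>The Yoneda step: naturality along \<open>g\<close> itself, evaluated at the
      identity of \<open>objs X\<close>.\<close>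
    have eq: "\<alpha> S g = compose (objs (FOb H S)) (\<alpha> (objs X) ?id) (FMor H S (objs X) g)"
      if S: "small S" and g: "g \<in> S \<rightarrow>\<^sub>E objs X" for S g
    proof -
      have "compose S ?id g = g"
        using g by (auto simp: compose_def fun_eq_iff PiE_def extensional_def)
      then show ?thesis
        using nat val[OF X(2) id] S X(2) g id unfolding nat_iff by metis
    qed
    have "r \<le> dist Y (\<alpha> (objs X) ?id (Hd0 H pair X r C)) (\<alpha> (objs X) ?id (Hd1 H pair X r C))"
      if C: "C \<in> objs (FOb H (threshold pair X r))" for r C
    proof -
      let ?T = "threshold pair X r"
      have T: "small ?T" by (rule small_threshold[OF X(2)])
      \<comment> \<open>As elements of the weight at \<open>?T\<close>, the two projections are at
        distance at least \<open>r\<close>; the V-functor \<open>\<alpha> ?T\<close> preserves this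
        bound.\<close>
      have "r \<le> dist (vfun (discrete ?T) X) (d0 pair X r) (d1 pair X r)"
        unfolding dist_vfun by (intro INF_greatest le_dist_d) simp
      also have "\<dots> \<le> dist (vfun (FOb H ?T) Y) (\<alpha> ?T (d0 pair X r)) (\<alpha> ?T (d1 pair X r))"
        using vf[OF T] d_mem[of X r] weight[of ?T] by (intro vfunctor_dist) auto
      also have "\<dots> \<le> dist Y (\<alpha> ?T (d0 pair X r) C) (\<alpha> ?T (d1 pair X r) C)"
        unfolding dist_vfun by (rule INF_lower[OF C])
      finally show ?thesis
        using eq[OF T d_mem(1)] eq[OF T d_mem(2)] C by (simp add: Hd0_def Hd1_def compose_eq)
    qed
    then have "cocone H pair X Y (\<alpha> (objs X) ?id)"
      using val[OF X(2) id] by (auto simp: cocone_def intro!: INF_greatest)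
    then show "\<alpha> (objs X) ?id \<in> objs (vfun (sharp X) Y)"
      using cocone_iff[OF X(2) Y] by simp
    \<comment> \<open>Equality as HOL functions also concerns arguments off the small sets and off
      the weight, where extensionality makes both sides \<open>undefined\<close>.\<close>
    show "\<Phi> (\<alpha> (objs X) ?id) = \<alpha>"
    proof (rule ext, rule ext)
      fix S g
      show "\<Phi> (\<alpha> (objs X) ?id) S g = \<alpha> S g"
      proof (cases "small S")
        case S: True
        show ?thesis
        proof (cases "g \<in> S \<rightarrow>\<^sub>E objs X")
          case True
          then show ?thesis using \<Phi>_apply[OF S True] eq[OF S True] by simp
        next
          case False
          then have "g \<notin> objs (vfun (discrete S) X)" by (simp add: weight del: mem_vfun)
          moreover have "\<alpha> S \<in> extensional (objs (vfun (discrete S) X))"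
            using vf[OF S] by simp
          ultimately show ?thesis
            by (simp add: \<Phi>_def W_Ob SetC_def S extensional_def del: mem_vfun)
        qed
      next
        case False
        then show ?thesis using \<alpha> by (simp add: \<Phi>_def SetC_def extensional_def)
      qed
    qed
  qed
  have iso: "vcat_iso (vfun (sharp X) Y)
      (nat_hom (opposite SetV) ?W (hom_into (VCat small) H Y)) \<Phi>"
    if Y: "vcategory Y" "small (objs Y)" for Y :: "('u, 'v) vcat"
    unfolding vcat_iso_def
  proof (intro conjI ballI)
    let ?N = "nat_hom (opposite SetV) ?W (hom_into (VCat small) H Y)"
    have N: "\<alpha> \<in> objs ?N \<longleftrightarrow> \<alpha> \<in> extensional (EOb SetV) \<and>
        vcat_nat (opposite SetV) ?W (hom_into (VCat small) H Y) \<alpha>" for \<alpha>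
      by (simp add: nat_hom_def opposite_def)
    show "bij_betw \<Phi> (objs (vfun (sharp X) Y)) (objs ?N)"
    proof (rule bij_betw_byWitness[where f' = "\<lambda>\<alpha>. \<alpha> (objs X) ?id"])
      show "\<forall>f\<in>objs (vfun (sharp X) Y). \<Phi> f (objs X) ?id = f"
        by (intro ballI \<Phi>_id)
      show "\<forall>\<alpha>\<in>objs ?N. \<Phi> (\<alpha> (objs X) ?id) = \<alpha>"
        by (intro ballI \<alpha>_id(2)[OF Y(1)]) (simp_all add: N)
      show "\<Phi> ` objs (vfun (sharp X) Y) \<subseteq> objs ?N"
      proof (rule image_subsetI)
        fix f assume "f \<in> objs (vfun (sharp X) Y)"
        moreover have "\<Phi> f \<in> extensional (EOb SetV)"
          by (simp add: \<Phi>_def)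
        ultimately show "\<Phi> f \<in> objs ?N"
          using \<Phi>_nat[OF Y(1)] by (simp add: N)
      qed
      show "(\<lambda>\<alpha>. \<alpha> (objs X) ?id) ` objs ?N \<subseteq> objs (vfun (sharp X) Y)"
        by (intro image_subsetI \<alpha>_id(1)[OF Y(1)]) (simp_all add: N)
    qed
    fix f f' assume f: "f \<in> objs (vfun (sharp X) Y)" and f': "f' \<in> objs (vfun (sharp X) Y)"
    have "dist ?N (\<Phi> f) (\<Phi> f') = (INF S\<in>{S. small S}. INF g\<in>S \<rightarrow>\<^sub>E objs X. INF B\<in>objs (FOb H S).
        dist Y (\<Phi> f S g B) (\<Phi> f' S g B))"
      unfolding nat_hom_def by (simp add: opposite_def SetC_def dist_vfun weight hom_into_def VCat_def Disc_def)
    also have "\<dots> = (INF S\<in>{S. small S}. INF g\<in>S \<rightarrow>\<^sub>E objs X. INF B\<in>objs (FOb H S).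
        dist Y (f (FMor H S (objs X) g B)) (f' (FMor H S (objs X) g B)))"
      using \<Phi>_apply by (intro INF_cong refl) (simp add: compose_eq)
    \<comment> \<open>Choosing \<open>S = objs X\<close> and \<open>g\<close> the identity reaches
      every \<open>A\<close>; conversely each \<open>FMor H S (objs X) g B\<close> is such an
      \<open>A\<close>.\<close>
    also have "\<dots> = (INF A\<in>objs (sharp X). dist Y (f A) (f' A))"
    proof (rule antisym)
      show "(INF S\<in>{S. small S}. INF g\<in>S \<rightarrow>\<^sub>E objs X. INF B\<in>objs (FOb H S).
          dist Y (f (FMor H S (objs X) g B)) (f' (FMor H S (objs X) g B)))
        \<le> (INF A\<in>objs (sharp X). dist Y (f A) (f' A))"
      proof (rule INF_greatest)
        fix A assume A: "A \<in> objs (sharp X)"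
        have "(INF S\<in>{S. small S}. INF g\<in>S \<rightarrow>\<^sub>E objs X. INF B\<in>objs (FOb H S).
            dist Y (f (FMor H S (objs X) g B)) (f' (FMor H S (objs X) g B)))
          \<le> dist Y (f (FMor H (objs X) (objs X) ?id A)) (f' (FMor H (objs X) (objs X) ?id A))"
          by (rule INF_lower2[of "objs X"], use X in simp, rule INF_lower2[OF id],
              rule INF_lower2[of A]) (use A in auto)
        then show "(INF S\<in>{S. small S}. INF g\<in>S \<rightarrow>\<^sub>E objs X. INF B\<in>objs (FOb H S).
            dist Y (f (FMor H S (objs X) g B)) (f' (FMor H S (objs X) g B))) \<le> dist Y (f A) (f' A)"
          using A H_id[OF X(2)] by simp
      qed
      show "(INF A\<in>objs (sharp X). dist Y (f A) (f' A))
        \<le> (INF S\<in>{S. small S}. INF g\<in>S \<rightarrow>\<^sub>E objs X. INF B\<in>objs (FOb H S).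
          dist Y (f (FMor H S (objs X) g B)) (f' (FMor H S (objs X) g B)))"
        using H_Mor_mem X(2) by (intro INF_greatest INF_lower) simp
    qed
    finally show "dist (vfun (sharp X) Y) f f' = dist ?N (\<Phi> f) (\<Phi> f')"
      by (simp add: dist_vfun)
  qed
  \<comment> \<open>The cylinder is the image under \<open>\<Phi>\<close> of the identity of
    \<open>sharp X\<close>, so its naturality is an instance of \<open>\<Phi>_nat\<close>. Agreement
    at small \<open>S\<close> is enough, as \<open>nat_iff\<close> reads no other values.\<close>
  have "vcat_nat (opposite SetV) ?W (hom_into (VCat small) H (sharp X)) ?xi"
  proof -
    have "vfunctor (sharp X) (sharp X) (\<lambda>A\<in>objs (sharp X). A)"
      by (auto simp: vfunctor_def)
    from \<Phi>_nat[OF sharp_Ob(1)[OF X] this]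
    have "vcat_nat (opposite SetV) ?W (hom_into (VCat small) H (sharp X))
        (\<Phi> (\<lambda>A\<in>objs (sharp X). A))" .
    moreover have "\<Phi> (\<lambda>A\<in>objs (sharp X). A) S = ?xi S" if S: "small S" for S
    proof -
      have "compose (objs (FOb H S)) (\<lambda>A\<in>objs (sharp X). A) (FMor H S (objs X) g) = FMor H S (objs X) g"
        if g: "g \<in> S \<rightarrow>\<^sub>E objs X" for g
        using H_Mor_mem[OF S X(2) g] H_Mor(1)[OF S X(2) g]
        by (auto simp: compose_def fun_eq_iff extensional_def)
      then show ?thesis
        using S by (auto simp: \<Phi>_def SetC_def W_Ob weight fun_eq_iff simp del: mem_vfun)
    qed
    ultimately show ?thesis
      unfolding nat_iff by (simp del: mem_vfun)
  qed
  then show ?thesis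
    unfolding weighted_colimit_def
    using vcat_functor_hom_into[OF vcat_functor_Disc, of X small] functorial sharp_Ob[OF X] X iso[unfolded \<Phi>_def]
    by (auto simp: VCat_def)
qed

text \<open>Composing with the unit changes nothing on extensional maps, so the prescribed cylinder
  reduces to the action of \<open>H\<close> and the weighted colimit already found can be
  transferred.\<close>

lemma left_kan_extension_Lan:
  "left_kan_extension SetV (VCat small) small Disc H Lan (\<lambda>S. kan_unit (discrete S))"
  unfolding left_kan_extension_def
proof (intro conjI ballI)
  show "vcat_functor SetV (VCat small) (Disc :: ('u set, 'u \<Rightarrow> 'u, ('u, 'v) vcat, 'u \<Rightarrow> 'u) efunctor)"
    by (rule vcat_functor_Disc)
  show "vcat_functor SetV (VCat small) H" by (rule functorial)
  show "vcat_functor (VCat small) (VCat small) Lan" by (rule vcat_functor_Lan)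
  show "vcat_nat SetV H (efunctor_comp Lan Disc) (\<lambda>S. kan_unit (discrete S))"
    by (rule kan_unit_natural)
  fix X :: "('u, 'v) vcat" assume "X \<in> EOb (VCat small)"
  then have X: "vcategory X" "small (objs X)" by (auto simp: VCat_def)
  have "compose (objs (FOb H S)) (FMor H S (objs X) g) (kan_unit (discrete S)) = FMor H S (objs X) g"
    if "small S" "g \<in> objs (vfun (discrete S) X)" for S g
    using that H_Mor(1)[OF _ X(2)] unfolding weight_eq[OF X(1)]
    by (auto simp: compose_def kan_unit_def fun_eq_iff extensional_def)
  then have eq: "(\<lambda>g\<in>objs (vfun (discrete S) X). FMor H S (objs X) g) =
      (\<lambda>g\<in>objs (EHom (VCat small) (FOb Disc S) X).
        compose (objs (FOb H S)) (FMor Lan (FOb Disc S) X g) (kan_unit (discrete S)))"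
    if "S \<in> EOb SetV" for S
    using that by (auto simp: SetC_def VCat_def Disc_def fun_eq_iff restrict_def simp del: mem_vfun)
  show "weighted_colimit SetV (hom_into (VCat small) Disc X) small H (FOb Lan X)
     (\<lambda>S. \<lambda>g\<in>objs (EHom (VCat small) (FOb Disc S) X).
        compose (objs (FOb H S)) (FMor Lan (FOb Disc S) X g) (kan_unit (discrete S)))"
    using weighted_colimit_cong[OF eq weighted_colimit_sharp[OF X]] by simp
qed

text \<open>Since composition with \<open>kan_unit X\<close> fixes every extensional map, a cocone
  is its own unique factorization, and the two infima compared are literally the same.\<close>

lemma couniversal_cocone_kan_unit:
  assumes X: "vcategory X" "small (objs X)"
  shows "couniversal_cocone small H pair X (sharp X) (kan_unit X)"
proof -
  have kan_unit: "kan_unit X \<in> objs (vfun (sharp X) (sharp X))"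
    by (auto simp: kan_unit_def vfunctor_def)
  have comp: "compose (objs (FOb H (objs X))) f (kan_unit X) = f"
    if "f \<in> objs (vfun (sharp X) Y)" for f and Y :: "('u, 'v) vcat"
    using that by (auto simp: compose_def kan_unit_def fun_eq_iff extensional_def)
  show ?thesis
    unfolding couniversal_cocone_def
  proof (intro conjI ballI allI impI)
    show "sharp X \<in> EOb (VCat small)"
      using sharp_Ob[OF X] by (simp add: VCat_def)
    show "cocone H pair X (sharp X) (kan_unit X)"
      using kan_unit cocone_iff[OF X(2) sharp_Ob(1)[OF X]] by blast
    fix Y :: "('u, 'v) vcat" and f
    assume "Y \<in> EOb (VCat small)"
    then have Y: "vcategory Y" by (simp add: VCat_def)
    show "\<exists>!f'. f' \<in> objs (vfun (sharp X) Y) \<and> f = compose (objs (FOb H (objs X))) f' (kan_unit X)"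
      if "cocone H pair X Y f"
      using that comp cocone_iff[OF X(2) Y] by (intro ex1I[of _ f]) auto
    fix g f' g'
    assume "f' \<in> objs (vfun (sharp X) Y)" "g' \<in> objs (vfun (sharp X) Y)"
      "f = compose (objs (FOb H (objs X))) f' (kan_unit X)" "g = compose (objs (FOb H (objs X))) g' (kan_unit X)"
    then show "(INF B\<in>objs (FOb H (objs X)). dist Y (f B) (g B)) = (INF A\<in>objs (sharp X). dist Y (f' A) (g' A))"
      using comp by (simp del: mem_vfun)
  qed
qed

end

theorem corollary3p10:
  fixes small :: "'u set \<Rightarrow> bool"
    and pair :: "'u \<times> 'u \<Rightarrow> 'u"
    and H :: "('u set, 'u \<Rightarrow> 'u, ('u, 'v::comm_quantale) vcat, 'u \<Rightarrow> 'u) efunctor"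
  assumes "set_universe small pair"
    and "vcat_functor (SetC small) (VCat small) H"
  shows "\<exists>(L :: (('u, 'v) vcat, 'u \<Rightarrow> 'u, ('u, 'v) vcat, 'u \<Rightarrow> 'u) efunctor)
          (c :: ('u, 'v) vcat \<Rightarrow> 'u \<Rightarrow> 'u).
     left_kan_extension (SetC small) (VCat small) small Disc H L (\<lambda>S. c (discrete S)) \<and>
     (\<forall>X\<in>EOb (VCat small).
        objs (FOb L X) = objs (FOb H (objs X)) \<and>
        (\<forall>A'\<in>objs (FOb L X). \<forall>A\<in>objs (FOb L X).
           dist (FOb L X) A' A = Sup (path_values H pair X A' A))) \<and>
     (\<forall>X\<in>EOb (VCat small).
        couniversal_cocone small H pair X (FOb L X) (c X) \<and>
        (\<forall>A\<in>objs (FOb H (objs X)). c X A = A)) \<and>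
     (\<forall>X\<in>EOb (VCat small). \<forall>Y\<in>EOb (VCat small). \<forall>f\<in>objs (EHom (VCat small) X Y).
        \<forall>A\<in>objs (FOb L X). FMor L X Y f A = FMor H (objs X) (objs Y) f A)"
proof -
  interpret set_functor small pair H
    using assms by unfold_locales
  show ?thesis
    using left_kan_extension_Lan dist_sharp_eq couniversal_cocone_kan_unit
    by (intro exI[of _ Lan] exI[of _ kan_unit]) (auto simp: VCat_def kan_unit_def)
qed

end
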